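(* Let $m\ge2$, $d\ge1$ be integers. Then $${\rm Det}(U)=\overline{{\rm Det}(\overline{U})},\qquad\forall\,U\in C\ell^{\frac1m}_d,$$ where the outer bar is complex conjugation in $\mathbb{C}$ and the inner bar is Hermitian conjugation in $C\ell^{\frac1m}_d$.
   Context: The generalized Clifford algebra $C\ell^{\frac1m}_d$ is the unital associative algebra over $\mathbb{C}$ with identity $e$ and generators $e_1,\dots,e_d$ subject to $e_j^m=e$ for $j=1,\dots,d$ and $e_ke_l=\omega e_le_k$ for $k<l$, where $\omega:=e^{2\pi i/m}$. It has dimension $m^d$ with basis $e_1^{j_1}\cdots e_d^{j_d}$, $0\le j_1,\dots,j_d\le m-1$ (each basis element is invertible), so each element is uniquely $U=\sum u_{j_1\ldots j_d}e_1^{j_1}\cdots e_d^{j_d}$ with $u_{j_1\ldots j_d}\in\mathbb{C}$. Hermitian conjugation: $\overline{U}:=\sum\overline{u_{j_1\ldots j_d}}\,(e_1^{j_1}\cdots e_d^{j_d})^{-1}$. Determinant: ${\rm Det}(U):=\det(\gamma(U))\in\mathbb{C}$, where $\gamma$ is any faithful matrix representation of minimal dimension, i.e. any isomorphism of unital complex algebras from $C\ell^{\frac1m}_d$ onto ${\rm Mat}(m^{\frac d2},\mathbb{C})$ if $d$ is even, and onto the direct sum of $m$ copies of ${\rm Mat}(m^{\frac{d-1}2},\mathbb{C})$, regarded as block-diagonal matrices of size $m^{\frac{d+1}{2}}$, if $d$ is odd; ${\rm Det}$ does not depend on the choice of $\gamma$. *)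

theory Defs
  imports
    "HOL-Algebra.QuotRing"
    "HOL-Library.Poly_Mapping"
    "Jordan_Normal_Form.Determinant"
begin

text \<open>
  The generalized Clifford algebra is the quotient of the free unital associative complex algebra
  on letters 1, ..., d by the two-sided ideal generated by the defining relations.  The free
  algebra consists of the finitely supported complex functions on words, multiplied by
  convolution (the product on polynomial mappings, which needs words as an additively written monoid).
\<close>

datatype nc_word = Word (letters: "nat list")

instantiation nc_word :: monoid_add
begin
definition "0 = Word []"
definition "v + w = Word (letters v @ letters w)"
instance by standard (auto simp: zero_nc_word_def plus_nc_word_def)
end

type_synonym nc_poly = "nc_word \<Rightarrow>\<^sub>0 complex"

definition nc_const :: "complex \<Rightarrow> nc_poly" where
  "nc_const c = Poly_Mapping.single 0 c"

definition nc_var :: "nat \<Rightarrow> nc_poly" where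
  "nc_var j = Poly_Mapping.single (Word [j]) 1"

definition free_alg :: "nat \<Rightarrow> nc_poly ring" where
  "free_alg d = \<lparr>carrier = {p. \<forall>w\<in>Poly_Mapping.keys p. set (letters w) \<subseteq> {1..d}},
     monoid.mult = (*), one = 1, zero = 0, add = (+)\<rparr>"

lemma in_free_alg:
  "p \<in> carrier (free_alg d) \<longleftrightarrow> (\<forall>w\<in>Poly_Mapping.keys p. set (letters w) \<subseteq> {1..d})"
  by (simp add: free_alg_def)

lemma free_alg_mult_closed:
  assumes "p \<in> carrier (free_alg d)" "q \<in> carrier (free_alg d)"
  shows "p * q \<in> carrier (free_alg d)"
  unfolding in_free_alg
proof
  fix w assume "w \<in> Poly_Mapping.keys (p * q)"
  then obtain u v where "u \<in> Poly_Mapping.keys p" "v \<in> Poly_Mapping.keys q" "w = u + v"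
    using keys_mult[of p q] by blast
  then show "set (letters w) \<subseteq> {1..d}"
    using assms unfolding in_free_alg plus_nc_word_def by (metis Un_least nc_word.sel set_append)
qed

lemma ring_free_alg: "ring (free_alg d)"
proof (rule ringI)
  have neg: "- p \<in> carrier (free_alg d)" if "p \<in> carrier (free_alg d)" for p
    using that by (simp add: in_free_alg)
  have add: "p + q \<in> carrier (free_alg d)"
    if "p \<in> carrier (free_alg d)" "q \<in> carrier (free_alg d)" for p q
    using that keys_add[of p q] unfolding in_free_alg by blast
  have zero: "0 \<in> carrier (free_alg d)" and one: "1 \<in> carrier (free_alg d)"
    by (simp_all add: in_free_alg zero_nc_word_def)
  have ops: "add (free_alg d) = (+)" "zero (free_alg d) = 0"
      "monoid.mult (free_alg d) = (*)" "one (free_alg d) = 1"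
    by (simp_all add: free_alg_def)
  show "abelian_group (free_alg d)"
  proof (rule abelian_groupI, unfold ops)
    fix p assume "p \<in> carrier (free_alg d)"
    then show "\<exists>q\<in>carrier (free_alg d). q + p = 0"
      using neg[of p] by (intro bexI[of _ "- p"]) simp_all
  qed (use add zero in \<open>simp_all add: add.assoc add.commute\<close>)
  show "monoid (free_alg d)"
    by (rule monoidI, unfold ops) (simp_all add: free_alg_mult_closed one mult.assoc)
  show "(p \<oplus>\<^bsub>free_alg d\<^esub> q) \<otimes>\<^bsub>free_alg d\<^esub> r =
      p \<otimes>\<^bsub>free_alg d\<^esub> r \<oplus>\<^bsub>free_alg d\<^esub> q \<otimes>\<^bsub>free_alg d\<^esub> r" for p q r
    unfolding ops by (rule distrib_right)
  show "r \<otimes>\<^bsub>free_alg d\<^esub> (p \<oplus>\<^bsub>free_alg d\<^esub> q) =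
      r \<otimes>\<^bsub>free_alg d\<^esub> p \<oplus>\<^bsub>free_alg d\<^esub> r \<otimes>\<^bsub>free_alg d\<^esub> q" for p q r
    unfolding ops by (rule distrib_left)
qed

definition gca_omega :: "nat \<Rightarrow> complex" where
  "gca_omega m = exp (2 * of_real pi * \<i> / of_nat m)"

definition gca_relators :: "nat \<Rightarrow> nat \<Rightarrow> nc_poly set" where
  "gca_relators m d =
     {nc_var j ^ m - 1 | j. j \<in> {1..d}} \<union>
     {nc_var k * nc_var l - nc_const (gca_omega m) * nc_var l * nc_var k | k l.
        1 \<le> k \<and> k < l \<and> l \<le> d}"

definition gca_ideal :: "nat \<Rightarrow> nat \<Rightarrow> nc_poly set" where
  "gca_ideal m d = Idl\<^bsub>free_alg d\<^esub> (gca_relators m d)"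

definition gca :: "nat \<Rightarrow> nat \<Rightarrow> nc_poly set ring" where
  "gca m d = free_alg d Quot gca_ideal m d"

lemma gca_relators_subset: "gca_relators m d \<subseteq> carrier (free_alg d)"
proof -
  have minus: "p - q \<in> carrier (free_alg d)"
    if "p \<in> carrier (free_alg d)" "q \<in> carrier (free_alg d)" for p q
    using that Poly_Mapping.keys_diff[of p q] unfolding in_free_alg by blast
  have var: "nc_var j \<in> carrier (free_alg d)" if "j \<in> {1..d}" for j
    using that by (simp add: in_free_alg nc_var_def)
  have const: "nc_const c \<in> carrier (free_alg d)" for c
    by (simp add: in_free_alg nc_const_def zero_nc_word_def)
  have one: "1 \<in> carrier (free_alg d)"
    by (simp add: in_free_alg zero_nc_word_def)
  have power: "p ^ n \<in> carrier (free_alg d)" if "p \<in> carrier (free_alg d)" for p n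
    by (induction n) (simp_all add: one that free_alg_mult_closed)
  show ?thesis
    unfolding gca_relators_def
    by (auto intro!: minus power free_alg_mult_closed var const one)
qed

lemma ideal_gca_ideal: "ideal (gca_ideal m d) (free_alg d)"
  unfolding gca_ideal_def
  by (rule ring.genideal_ideal[OF ring_free_alg gca_relators_subset])

lemma ring_gca: "ring (gca m d)"
  unfolding gca_def by (rule ideal.quotient_is_ring[OF ideal_gca_ideal])

definition gca_class :: "nat \<Rightarrow> nat \<Rightarrow> nc_poly \<Rightarrow> nc_poly set" where
  "gca_class m d p = gca_ideal m d +>\<^bsub>free_alg d\<^esub> p"

definition gca_smult :: "nat \<Rightarrow> nat \<Rightarrow> complex \<Rightarrow> nc_poly set \<Rightarrow> nc_poly set" where
  "gca_smult m d c U = gca_class m d (nc_const c) \<otimes>\<^bsub>gca m d\<^esub> U"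

definition gca_gen :: "nat \<Rightarrow> nat \<Rightarrow> nat \<Rightarrow> nc_poly set" where
  "gca_gen m d j = gca_class m d (nc_var j)"

definition gca_indices :: "nat \<Rightarrow> nat \<Rightarrow> (nat \<Rightarrow> nat) set" where
  "gca_indices m d = {1..d} \<rightarrow>\<^sub>E {0..<m}"

definition gca_monom :: "nat \<Rightarrow> nat \<Rightarrow> (nat \<Rightarrow> nat) \<Rightarrow> nc_poly set" where
  "gca_monom m d J =
     foldr (\<lambda>k V. (gca_gen m d k [^]\<^bsub>gca m d\<^esub> J k) \<otimes>\<^bsub>gca m d\<^esub> V) [1..<Suc d] \<one>\<^bsub>gca m d\<^esub>"

definition gca_coeffs :: "nat \<Rightarrow> nat \<Rightarrow> nc_poly set \<Rightarrow> (nat \<Rightarrow> nat) \<Rightarrow> complex" where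
  "gca_coeffs m d U =
     (THE u. u \<in> extensional (gca_indices m d) \<and>
        U = (\<Oplus>\<^bsub>gca m d\<^esub>J\<in>gca_indices m d. gca_smult m d (u J) (gca_monom m d J)))"

definition gca_conj :: "nat \<Rightarrow> nat \<Rightarrow> nc_poly set \<Rightarrow> nc_poly set" where
  "gca_conj m d U =
     (\<Oplus>\<^bsub>gca m d\<^esub>J\<in>gca_indices m d.
        gca_smult m d (cnj (gca_coeffs m d U J)) (inv\<^bsub>gca m d\<^esub> (gca_monom m d J)))"

text \<open>
  The target of a minimal faithful representation.  For odd d, the direct sum of m matrix
  algebras is realised as the ring of block-diagonal matrices with m blocks of equal size.
\<close>

definition gca_mat_size :: "nat \<Rightarrow> nat \<Rightarrow> nat" where
  "gca_mat_size m d = (if even d then m ^ (d div 2) else m ^ ((d + 1) div 2))"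

definition block_diag_mats :: "nat \<Rightarrow> nat \<Rightarrow> complex mat set" where
  "block_diag_mats m n =
     {diag_block_mat As | As. length As = m \<and> set As \<subseteq> carrier_mat n n}"

definition gca_mat_ring :: "nat \<Rightarrow> nat \<Rightarrow> complex mat ring" where
  "gca_mat_ring m d =
     (let R = ring_mat TYPE(complex) (gca_mat_size m d) ()
      in if even d then R
         else R\<lparr>carrier := block_diag_mats m (m ^ ((d - 1) div 2))\<rparr>)"

definition gca_reps :: "nat \<Rightarrow> nat \<Rightarrow> (nc_poly set \<Rightarrow> complex mat) set" where
  "gca_reps m d =
     {\<gamma> \<in> ring_iso (gca m d) (gca_mat_ring m d).
        \<forall>c. \<forall>U\<in>carrier (gca m d). \<gamma> (gca_smult m d c U) = c \<cdot>\<^sub>m \<gamma> U}"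

text \<open>
  The determinant is the common value over all minimal faithful representations; the definite
  description is meaningful only because such a representation exists and the value does not
  depend on it.
\<close>

definition gca_Det :: "nat \<Rightarrow> nat \<Rightarrow> nc_poly set \<Rightarrow> complex" where
  "gca_Det m d U = (THE z. \<exists>\<gamma>\<in>gca_reps m d. z = det (\<gamma> U))"

end

theory Submission
  imports Defs "Jordan_Normal_Form.Schur_Decomposition"
begin

text \<open>
  The algebra has an explicit minimal representation in which every generator is a unitary matrix.
  Monomials are then unitary as well, so Hermitian conjugation becomes the conjugate transpose, whose
  determinant is the complex conjugate.  The remaining point is that Det is well defined.  The
  monomial matrices are orthogonal for the trace form and as many as the dimension of the
  (block-diagonal) matrix algebra, so the representation is an isomorphism.  Any other minimal faithful
  representation differs from it by an automorphism of the matrix algebra, which preserves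
  traces, hence traces of powers, hence determinants.
\<close>

text \<open>The coefficients in \<open>gca_conj\<close> and the value of \<open>gca_Det\<close> are
  definite descriptions over a quotient ring, so nothing can be computed before the monomials are
  known to form a basis. Rewriting words modulo the relations shows only that they span.
  Independence comes from the matrices, and both facts together identify the ideal with the kernel
  of the representation.

  Independence is detected by phases: conjugating a monomial matrix by a generator matrix multiplies
  it by a power of \<omega>. These phases determine the exponents only for an even number of
  generators, since for odd \<open>d\<close> the algebra has nontrivial central monomials. An odd
  \<open>d\<close> is therefore placed inside d + 1 generators. The extra one separates the
  monomials from outside the algebra, and the first \<open>d\<close> matrices are block-diagonal
  because the outer tensor factor of the last of them is the diagonal clock matrix.

  For odd \<open>d\<close> an automorphism of the target may permute the blocks, so it need not be
  inner in the block algebra. The comparison of traces treats both parities alike.\<close>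

section \<open>Traces and determinants\<close>

definition mat_trace :: "'a::comm_monoid_add mat \<Rightarrow> 'a" where
  "mat_trace A = (\<Sum>i<dim_row A. A $$ (i, i))"

lemma mat_trace_carrier: "A \<in> carrier_mat n n \<Longrightarrow> mat_trace A = (\<Sum>i<n. A $$ (i, i))"
  by (auto simp: mat_trace_def)

lemma index_mult_mat_sum:
  assumes "A \<in> carrier_mat nr n" "B \<in> carrier_mat n nc" "i < nr" "j < nc"
  shows "(A * B) $$ (i, j) = (\<Sum>k<n. A $$ (i, k) * B $$ (k, j))"
  using assms by (auto simp: scalar_prod_def lessThan_atLeast0 intro!: sum.cong)

lemma mat_trace_comm:
  assumes "A \<in> carrier_mat n k" "B \<in> carrier_mat k n"
  shows "mat_trace (A * B) = mat_trace (B * A :: 'a::comm_semiring_0 mat)"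
proof -
  have "mat_trace (A * B) = (\<Sum>i<n. \<Sum>j<k. A $$ (i, j) * B $$ (j, i))"
    using assms index_mult_mat_sum[OF assms] by (simp add: mat_trace_def del: index_mult_mat)
      (auto intro!: sum.cong)
  also have "\<dots> = (\<Sum>j<k. \<Sum>i<n. B $$ (j, i) * A $$ (i, j))"
    by (subst sum.swap) (simp add: mult.commute)
  also have "\<dots> = mat_trace (B * A)"
    using assms index_mult_mat_sum[OF assms(2,1)] by (simp add: mat_trace_def del: index_mult_mat)
      (auto intro!: sum.cong)
  finally show ?thesis .
qed

section \<open>Eigenvalues read off a triangular form\<close>

lemma diag_mult_upper_triangular:
  assumes "A \<in> carrier_mat n n" "B \<in> carrier_mat n n"
    and "upper_triangular A" "upper_triangular B"
  shows "upper_triangular (A * B)"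
    and "i < n \<Longrightarrow> (A * B) $$ (i, i) = A $$ (i, i) * (B $$ (i, i) :: 'a::semiring_0)"
proof -
  have zero: "A $$ (i, k) * B $$ (k, j) = 0" if "i < n" "k < n" "k < i \<or> j < k" for i j k
    using that assms(1,2) upper_triangularD[OF assms(3), of k i] upper_triangularD[OF assms(4), of j k]
    by auto
  show "upper_triangular (A * B)"
  proof (rule upper_triangularI)
    fix i j assume "j < i" "i < dim_row (A * B)"
    then show "(A * B) $$ (i, j) = 0"
      using assms(1,2)
      by (subst index_mult_mat_sum[OF assms(1,2)])
        (auto intro!: sum.neutral zero simp del: mult_eq_0_iff)
  qed
  show "(A * B) $$ (i, i) = A $$ (i, i) * B $$ (i, i)" if "i < n"
  proof -
    have "(\<Sum>k<n. A $$ (i, k) * B $$ (k, i)) = (\<Sum>k\<in>{i}. A $$ (i, k) * B $$ (k, i))"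
      using that by (intro sum.mono_neutral_right) (auto intro!: zero)
    then show ?thesis
      using that by (subst index_mult_mat_sum[OF assms(1,2)]) auto
  qed
qed

lemma upper_triangular_pow:
  assumes "(B :: 'a::comm_semiring_1 mat) \<in> carrier_mat n n" "upper_triangular B"
  shows "upper_triangular (B ^\<^sub>m k) \<and> (\<forall>i<n. (B ^\<^sub>m k) $$ (i, i) = (B $$ (i, i)) ^ k)"
proof (induction k)
  case 0
  then show ?case using assms by (auto intro!: upper_triangularI)
next
  case (Suc k)
  then show ?case
    using diag_mult_upper_triangular[OF pow_carrier_mat[OF assms(1)] assms(1) _ assms(2), of k]
    by (auto simp add: mult.commute simp del: index_mult_mat)
qed

lemma complex_mat_triangularizable:
  assumes "A \<in> carrier_mat n n"
  obtains B P Q where "similar_mat_wit A (B :: complex mat) P Q" "upper_triangular B"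
    "B \<in> carrier_mat n n" "P \<in> carrier_mat n n" "Q \<in> carrier_mat n n"
proof -
  obtain es where es: "char_poly A = (\<Prod>a\<leftarrow>es. [:- a, 1:])"
    using char_poly_factorized[OF assms] by blast
  obtain B P Q where "schur_decomposition A es = (B, P, Q)"
    by (cases "schur_decomposition A es")
  from schur_decomposition[OF assms es this] show ?thesis
    using similar_mat_witD2[OF assms, of B P Q] by (intro that[of B P Q]) auto
qed

lemma mat_trace_similar:
  assumes "A \<in> carrier_mat n n" "similar_mat_wit A B P Q"
  shows "mat_trace A = mat_trace (B :: 'a::comm_ring_1 mat)"
proof -
  note D = similar_mat_witD2[OF assms]
  have "mat_trace A = mat_trace (P * (B * Q))"
    unfolding D(3) by (rule arg_cong[OF assoc_mult_mat[OF D(6,5,7)]])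
  also have "\<dots> = mat_trace ((B * Q) * P)"
    by (rule mat_trace_comm[OF D(6) mult_carrier_mat[OF D(5,7)]])
  also have "(B * Q) * P = B"
    unfolding assoc_mult_mat[OF D(5,7,6)] D(2) by (rule right_mult_one_mat[OF D(5)])
  finally show ?thesis .
qed

text \<open>The witness is the diagonal of a Schur form: determinant and trace are similarity
  invariants, and powers of a triangular matrix have the powers of its diagonal. The conclusions are
  bundled so that they speak of the same \<open>e\<close>.\<close>

lemma complex_mat_eigenvalues:
  assumes "A \<in> carrier_mat n n"
  shows "\<exists>e :: nat \<Rightarrow> complex. det A = (\<Prod>i<n. e i) \<and> (\<forall>k. mat_trace (A ^\<^sub>m k) = (\<Sum>i<n. e i ^ k)) \<and>
    (A * A = A \<longrightarrow> (\<forall>i<n. e i * e i = e i))"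
proof -
  obtain B P Q where B: "similar_mat_wit A B P Q" "upper_triangular B"
    "B \<in> carrier_mat n n" "P \<in> carrier_mat n n" "Q \<in> carrier_mat n n"
    by (rule complex_mat_triangularizable[OF assms])
  define e where "e i = B $$ (i, i)" for i
  have pow: "(B ^\<^sub>m k) $$ (i, i) = e i ^ k" if "i < n" for i k
    using upper_triangular_pow[OF B(3,2)] that by (simp add: e_def)
  have "det A = det B"
    using B(1) by (intro det_similar) (auto simp: similar_mat_def)
  also have "\<dots> = (\<Prod>i<n. e i)"
    using B(3) by (subst det_upper_triangular[OF B(2,3)])
      (auto simp: diag_mat_def e_def prod.list_conv_set_nth lessThan_atLeast0)
  finally have "det A = (\<Prod>i<n. e i)" .
  moreover have "mat_trace (A ^\<^sub>m k) = (\<Sum>i<n. e i ^ k)" for k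
  proof -
    have "mat_trace (A ^\<^sub>m k) = mat_trace (B ^\<^sub>m k)"
      by (rule mat_trace_similar[OF pow_carrier_mat[OF assms] similar_mat_wit_pow[OF B(1)]])
    then show ?thesis
      using pow B(3) by (simp add: mat_trace_carrier[of _ n])
  qed
  moreover have "e i * e i = e i" if idem: "A * A = A" and i: "i < n" for i
  proof -
    have "A ^\<^sub>m 2 = A"
      using idem assms by (simp add: numeral_2_eq_2)
    moreover have "A ^\<^sub>m 1 = A"
      using assms by simp
    ultimately have "B ^\<^sub>m 2 = B ^\<^sub>m 1"
      using similar_mat_wit_pow_id[OF similar_mat_wit_sym[OF B(1)]] by metis
    then have "e i ^ 2 = e i ^ 1"
      using pow[OF i] by metis
    then show ?thesis by (simp add: power2_eq_square)
  qed
  ultimately show ?thesis by blast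
qed

text \<open>Equal power sums give equal sums of values for every polynomial. A polynomial vanishing
  on all values except x then compares the multiplicities of x in both families; characteristic 0
  turns this into an equality of natural numbers.\<close>

lemma power_sums_determine_product:
  fixes e f :: "nat \<Rightarrow> 'a::{field_char_0}"
  assumes "\<And>k. (\<Sum>i<n. e i ^ k) = (\<Sum>i<n. f i ^ k)"
  shows "(\<Prod>i<n. e i) = (\<Prod>i<n. f i)"
proof -
  define S where "S = e ` {..<n} \<union> f ` {..<n}"
  have fin: "finite S" by (simp add: S_def)
  have "(\<Sum>i<n. poly p (g i)) = (\<Sum>k\<le>degree p. coeff p k * (\<Sum>i<n. g i ^ k))" for p :: "'a poly" and g
    unfolding poly_altdef sum_distrib_left by (rule sum.swap)
  then have poly: "(\<Sum>i<n. poly p (e i)) = (\<Sum>i<n. poly p (f i))" for p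
    using assms by simp
  have count: "card {i. i < n \<and> e i = x} = card {i. i < n \<and> f i = x}" if "x \<in> S" for x
  proof -
    \<comment> \<open>An unnormalised Lagrange polynomial: only its being nonzero at x and zero on
      the rest of \<open>S\<close> matters, since the factor \<open>poly p x\<close>
      cancels.\<close>
    define p where "p = (\<Prod>y\<in>S - {x}. [:- y, 1:])"
    have px: "poly p x \<noteq> 0"
      using fin by (auto simp: p_def poly_prod)
    have py: "poly p y = 0" if "y \<in> S" "y \<noteq> x" for y
      unfolding p_def poly_prod using fin that by (intro prod_zero) auto
    have ev: "(\<Sum>i<n. poly p (g i)) = of_nat (card {i. i < n \<and> g i = x}) * poly p x"
      if "g ` {..<n} \<subseteq> S" for g :: "nat \<Rightarrow> 'a"
    proof -
      have "(\<Sum>i<n. poly p (g i)) = (\<Sum>i\<in>{i. i < n \<and> g i = x}. poly p (g i))"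
        using that by (intro sum.mono_neutral_right) (auto intro!: py)
      also have "\<dots> = (\<Sum>i\<in>{i. i < n \<and> g i = x}. poly p x)"
        by (intro sum.cong) auto
      finally show ?thesis by simp
    qed
    show ?thesis
      using poly[of p] ev[of e] ev[of f] px by (simp add: S_def)
  qed
  have prod: "(\<Prod>i<n. g i) = (\<Prod>x\<in>S. x ^ card {i. i < n \<and> g i = x})"
    if "g ` {..<n} \<subseteq> S" for g
  proof -
    have "(\<Prod>x\<in>S. \<Prod>i\<in>{i. i \<in> {..<n} \<and> g i = x}. g i) = (\<Prod>i<n. g i)"
      using fin that by (intro prod.group) auto
    moreover have "(\<Prod>i\<in>{i. i \<in> {..<n} \<and> g i = x}. g i) = x ^ card {i. i < n \<and> g i = x}" for x
      by (simp add: lessThan_def)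
    ultimately show ?thesis by simp
  qed
  have "(\<Prod>i<n. e i) = (\<Prod>x\<in>S. x ^ card {i. i < n \<and> e i = x})"
    by (rule prod) (auto simp: S_def)
  also have "\<dots> = (\<Prod>x\<in>S. x ^ card {i. i < n \<and> f i = x})"
    using count by simp
  also have "\<dots> = (\<Prod>i<n. f i)"
    by (rule prod[symmetric]) (auto simp: S_def)
  finally show ?thesis .
qed

lemma det_eq_of_mat_trace_pow_eq:
  fixes A B :: "complex mat"
  assumes "A \<in> carrier_mat n n" "B \<in> carrier_mat n n"
    and "\<And>k. mat_trace (A ^\<^sub>m k) = mat_trace (B ^\<^sub>m k)"
  shows "det A = det B"
proof -
  obtain e where e: "det A = (\<Prod>i<n. e i)" "\<And>k. mat_trace (A ^\<^sub>m k) = (\<Sum>i<n. e i ^ k)"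
    using complex_mat_eigenvalues[OF assms(1)] by blast
  obtain f where f: "det B = (\<Prod>i<n. f i)" "\<And>k. mat_trace (B ^\<^sub>m k) = (\<Sum>i<n. f i ^ k)"
    using complex_mat_eigenvalues[OF assms(2)] by blast
  show ?thesis
    unfolding e(1) f(1) by (rule power_sums_determine_product) (simp only: e(2)[symmetric] f(2)[symmetric] assms(3))
qed

lemma idempotent_pow:
  assumes "A \<in> carrier_mat n n" "A * A = A"
  shows "A ^\<^sub>m Suc k = A"
proof (induction k)
  case 0
  show ?case using assms(1) by simp
next
  case (Suc k)
  show ?case using Suc.IH assms(2) pow_mat.simps(2)[of A "Suc k"] by metis
qed

lemma minus_zero_mat: "C \<in> carrier_mat n m \<Longrightarrow> C - 0\<^sub>m n m = (C :: 'a::group_add mat)"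
  by (intro eq_matI) auto

text \<open>The eigenvalues are 0 or 1, so the trace counts the ones. If there were none, the
  complementary idempotent C = 1 - A would have the same traces of powers as the identity, hence
  determinant 1; being invertible and annihilated by A from the left, it would force A = 0.\<close>

lemma mat_trace_idempotent:
  assumes "A \<in> carrier_mat n n" "A * A = A" "(A :: complex mat) \<noteq> 0\<^sub>m n n"
  obtains r :: nat where "mat_trace A = of_nat r" "r \<ge> 1"
proof -
  obtain e where e: "\<And>k. mat_trace (A ^\<^sub>m k) = (\<Sum>i<n. e i ^ k)"
    "\<And>i. A * A = A \<Longrightarrow> i < n \<Longrightarrow> e i * e i = e i"
    using complex_mat_eigenvalues[OF assms(1)] by blast
  have e01: "e i = (if e i = 1 then 1 else 0)" if "i < n" for i
    using e(2)[OF assms(2) that] by auto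
  have "mat_trace A = mat_trace (A ^\<^sub>m 1)"
    using assms(1) by simp
  also have "\<dots> = (\<Sum>i<n. if e i = 1 then 1 else 0)"
    unfolding e power_one_right by (intro sum.cong e01) auto
  also have "\<dots> = of_nat (card {i \<in> {..<n}. e i = 1})"
    by (simp add: sum.If_cases Int_def)
  finally have tr: "mat_trace A = of_nat (card {i \<in> {..<n}. e i = 1})" .
  have "mat_trace A \<noteq> 0"
  proof
    assume tr0: "mat_trace A = 0"
    let ?C = "1\<^sub>m n - A"
    have C: "?C \<in> carrier_mat n n" by (rule minus_carrier_mat[OF assms(1)])
    have AC: "A * ?C = 0\<^sub>m n n"
      using assms by (subst mult_minus_distrib_mat[of A n n]) auto
    have "?C * ?C = 1\<^sub>m n * ?C - A * ?C"
      by (rule minus_mult_distrib_mat[OF one_carrier_mat assms(1) C])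
    also have "\<dots> = ?C"
      unfolding AC left_mult_one_mat[OF C] by (rule minus_zero_mat[OF C])
    finally have pow: "?C ^\<^sub>m Suc k = ?C" for k
      using idempotent_pow[OF C] by blast
    have one: "1\<^sub>m n ^\<^sub>m k = (1\<^sub>m n :: complex mat)" for k
      by (induction k) auto
    have tr1: "mat_trace ?C = mat_trace (1\<^sub>m n)"
      using assms(1) tr0 by (simp add: mat_trace_def sum_subtractf)
    have "mat_trace (?C ^\<^sub>m k) = mat_trace (1\<^sub>m n ^\<^sub>m k)" for k
    \<comment> \<open>Idempotency collapses the powers only from exponent 1 on; at exponent 0 both
      sides are the identity.\<close>
    proof (cases k)
      case 0
      then show ?thesis using assms(1) by simp
    next
      case (Suc l)
      show ?thesis unfolding Suc pow one by (rule tr1)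
    qed
    then have "det ?C = det (1\<^sub>m n)"
      by (intro det_eq_of_mat_trace_pow_eq[OF C one_carrier_mat]) 
    then have "det ?C = 1" by simp
    then have "?C \<in> Units (ring_mat TYPE(complex) n ())"
      by (intro det_non_zero_imp_unit[OF C]) simp
    then obtain D where D: "D \<in> carrier_mat n n" "?C * D = 1\<^sub>m n"
      unfolding Units_def ring_mat_def by auto
    have "A = A * (?C * D)"
      unfolding D(2) using assms(1) by simp
    also have "\<dots> = (A * ?C) * D"
      by (rule assoc_mult_mat[symmetric, OF assms(1) C D(1)])
    also have "\<dots> = 0\<^sub>m n n"
      unfolding AC using D(1) by simp
    finally show False using assms(3) by simp
  qed
  then have "card {i \<in> {..<n}. e i = 1} \<noteq> 0"
    unfolding tr by (metis of_nat_0)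
  with tr show ?thesis by (intro that[of "card {i \<in> {..<n}. e i = 1}"]) linarith+
qed

section \<open>Endomorphisms of block-diagonal matrix algebras\<close>

text \<open>Described by entries and not by lists of blocks, so that closure properties become index
  computations. The case b = 1 is the full matrix algebra, which lets even and odd \<open>d\<close>
  share all later arguments; \<open>block_diag_mats_eq\<close> links this to the list form.\<close>

definition block_mats :: "nat \<Rightarrow> nat \<Rightarrow> complex mat set" where
  "block_mats b n = {X \<in> carrier_mat (b * n) (b * n).
     \<forall>i<b * n. \<forall>j<b * n. i div n \<noteq> j div n \<longrightarrow> X $$ (i, j) = 0}"

lemma block_matsI:
  assumes "X \<in> carrier_mat (b * n) (b * n)"
    and "\<And>i j. i < b * n \<Longrightarrow> j < b * n \<Longrightarrow> i div n \<noteq> j div n \<Longrightarrow> X $$ (i, j) = 0"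
  shows "X \<in> block_mats b n"
  using assms by (auto simp: block_mats_def)

lemma block_matsD:
  assumes "X \<in> block_mats b n"
  shows "X \<in> carrier_mat (b * n) (b * n)"
    and "i < b * n \<Longrightarrow> j < b * n \<Longrightarrow> i div n \<noteq> j div n \<Longrightarrow> X $$ (i, j) = 0"
  using assms by (auto simp: block_mats_def)

lemma block_mats_single: "block_mats 1 n = carrier_mat n n"
  by (auto simp: block_mats_def)

lemma block_mats_closed:
  shows one_in_block_mats: "1\<^sub>m (b * n) \<in> block_mats b n"
    and zero_in_block_mats: "0\<^sub>m (b * n) (b * n) \<in> block_mats b n"
    and mult_in_block_mats: "X \<in> block_mats b n \<Longrightarrow> Y \<in> block_mats b n \<Longrightarrow> X * Y \<in> block_mats b n"
    and add_in_block_mats: "X \<in> block_mats b n \<Longrightarrow> Y \<in> block_mats b n \<Longrightarrow> X + Y \<in> block_mats b n"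
    and smult_in_block_mats: "X \<in> block_mats b n \<Longrightarrow> c \<cdot>\<^sub>m X \<in> block_mats b n"
proof -
  show "1\<^sub>m (b * n) \<in> block_mats b n" "0\<^sub>m (b * n) (b * n) \<in> block_mats b n"
    by (auto simp: block_mats_def)
  show "X + Y \<in> block_mats b n" if "X \<in> block_mats b n" "Y \<in> block_mats b n"
    using that by (auto simp: block_mats_def)
  show "c \<cdot>\<^sub>m X \<in> block_mats b n" if "X \<in> block_mats b n"
    using that by (auto simp: block_mats_def)
  show "X * Y \<in> block_mats b n" if X: "X \<in> block_mats b n" and Y: "Y \<in> block_mats b n"
  proof (rule block_matsI)
    show "X * Y \<in> carrier_mat (b * n) (b * n)"
      by (rule mult_carrier_mat[OF block_matsD(1)[OF X] block_matsD(1)[OF Y]])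
    fix i j assume ij: "i < b * n" "j < b * n" "i div n \<noteq> j div n"
    have "X $$ (i, k) * Y $$ (k, j) = 0" if "k < b * n" for k
      using ij that block_matsD(2)[OF X, of i k] block_matsD(2)[OF Y, of k j] by fastforce
    then show "(X * Y) $$ (i, j) = 0"
      unfolding index_mult_mat_sum[OF block_matsD(1)[OF X] block_matsD(1)[OF Y] ij(1,2)]
      by (intro sum.neutral) blast
  qed
qed

lemma pow_in_block_mats:
  assumes "X \<in> block_mats b n"
  shows "X ^\<^sub>m k \<in> block_mats b n"
proof (induction k)
  case 0
  have "dim_row X = b * n" using block_matsD(1)[OF assms] by blast
  then show ?case by (simp add: one_in_block_mats)
qed (simp add: mult_in_block_mats assms)

section \<open>Matrix units and the trace pulled back along an endomorphism\<close>

definition unit_mat :: "nat \<Rightarrow> nat \<Rightarrow> nat \<Rightarrow> complex mat" where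
  "unit_mat N i j = mat N N (\<lambda>p. if p = (i, j) then 1 else 0)"

lemma unit_mat_carrier [simp]: "unit_mat N i j \<in> carrier_mat N N"
  by (simp add: unit_mat_def)

lemma unit_mat_mult:
  assumes "j < N"
  shows "unit_mat N i j * unit_mat N k l = (if j = k then unit_mat N i l else 0\<^sub>m N N)"
proof (rule eq_matI)
  fix a c assume "a < dim_row (if j = k then unit_mat N i l else 0\<^sub>m N N)"
    "c < dim_col (if j = k then unit_mat N i l else 0\<^sub>m N N)"
  then have ac: "a < N" "c < N"
    by (auto simp: unit_mat_def split: if_splits)
  have "(unit_mat N i j * unit_mat N k l) $$ (a, c)
      = (\<Sum>q<N. unit_mat N i j $$ (a, q) * unit_mat N k l $$ (q, c))"
    by (rule index_mult_mat_sum[OF unit_mat_carrier unit_mat_carrier ac])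
  also have "\<dots> = (\<Sum>q<N. (if q = j then if a = i \<and> j = k \<and> c = l then 1 else 0 else 0))"
    using ac by (intro sum.cong) (auto simp: unit_mat_def)
  also have "\<dots> = (if j = k then unit_mat N i l else 0\<^sub>m N N) $$ (a, c)"
    using ac assms by (auto simp: unit_mat_def)
  finally show "(unit_mat N i j * unit_mat N k l) $$ (a, c)
      = (if j = k then unit_mat N i l else 0\<^sub>m N N) $$ (a, c)" .
qed (auto simp: unit_mat_def)

lemma unit_mat_in_block_mats: "i div n = j div n \<Longrightarrow> unit_mat (b * n) i j \<in> block_mats b n"
  by (intro block_matsI) (auto simp: unit_mat_def)

text \<open>
  An injective endomorphism of the block algebra preserves the trace: off-diagonal matrix units are
  commutators, and the diagonal ones go to nonzero idempotents, whose traces are positive integers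
  adding up to the size.  Traces of powers then determine the determinant, so no
  Skolem--Noether theorem is needed.
\<close>

lemma det_block_mats_endomorphism:
  assumes carr: "\<And>X. X \<in> block_mats b n \<Longrightarrow> \<phi> X \<in> carrier_mat (b * n) (b * n)"
    and add: "\<And>X Y. X \<in> block_mats b n \<Longrightarrow> Y \<in> block_mats b n \<Longrightarrow> \<phi> (X + Y) = \<phi> X + \<phi> Y"
    and mult: "\<And>X Y. X \<in> block_mats b n \<Longrightarrow> Y \<in> block_mats b n \<Longrightarrow> \<phi> (X * Y) = \<phi> X * \<phi> Y"
    and smult: "\<And>c X. X \<in> block_mats b n \<Longrightarrow> \<phi> (c \<cdot>\<^sub>m X) = c \<cdot>\<^sub>m \<phi> X"
    and one: "\<phi> (1\<^sub>m (b * n)) = 1\<^sub>m (b * n)"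
    and inj: "inj_on \<phi> (block_mats b n)"
    and X: "X \<in> block_mats b n"
  shows "det (\<phi> X) = det X"
proof -
  let ?N = "b * n" and ?B = "block_mats b n"
  let ?E = "unit_mat (b * n)"
  define T where "T X = mat_trace (\<phi> X)" for X
  have T_add: "T (X + Y) = T X + T Y" if "X \<in> ?B" "Y \<in> ?B" for X Y
    unfolding T_def add[OF that] mat_trace_carrier[OF carr[OF that(1)]]
      mat_trace_carrier[OF carr[OF that(2)]] mat_trace_carrier[OF add_carrier_mat[OF carr[OF that(2)]]]
      sum.distrib[symmetric]
    using carr[OF that(1)] carr[OF that(2)] by (intro sum.cong) auto
  have T_smult: "T (c \<cdot>\<^sub>m X) = c * T X" if "X \<in> ?B" for c X
    unfolding T_def smult[OF that] mat_trace_carrier[OF carr[OF that]]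
      mat_trace_carrier[OF smult_carrier_mat[OF carr[OF that]]] sum_distrib_left
    using carr[OF that] by (intro sum.cong) auto
  have \<phi>_zero: "\<phi> (0\<^sub>m ?N ?N) = 0\<^sub>m ?N ?N"
  proof -
    have "\<phi> (0\<^sub>m ?N ?N) = \<phi> (0 \<cdot>\<^sub>m 0\<^sub>m ?N ?N)" by simp
    also have "\<dots> = 0 \<cdot>\<^sub>m \<phi> (0\<^sub>m ?N ?N)" by (rule smult[OF zero_in_block_mats])
    also have "\<dots> = 0\<^sub>m ?N ?N" using carr[OF zero_in_block_mats] by auto
    finally show ?thesis .
  qed
  then have T_zero: "T (0\<^sub>m ?N ?N) = 0"
    by (simp add: T_def mat_trace_def)
  have T_comm: "T (X * Y) = T (Y * X)" if "X \<in> ?B" "Y \<in> ?B" for X Y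
    unfolding T_def mult[OF that] mult[OF that(2,1)]
    by (rule mat_trace_comm[OF carr[OF that(1)] carr[OF that(2)]])
  have T_off_diag: "T (?E i j) = 0" if "i < ?N" "j < ?N" "i div n = j div n" "i \<noteq> j" for i j
    using T_comm[of "?E i i" "?E i j"] that
    by (simp add: unit_mat_in_block_mats unit_mat_mult T_zero)
  have "\<exists>r::nat. T (?E i i) = of_nat r \<and> r \<ge> 1" if i: "i < ?N" for i
  proof -
    have E: "?E i i \<in> ?B" by (simp add: unit_mat_in_block_mats)
    have "?E i i $$ (i, i) \<noteq> 0\<^sub>m ?N ?N $$ (i, i)"
      using i by (simp add: unit_mat_def)
    then have "?E i i \<noteq> 0\<^sub>m ?N ?N" by metis
    then have "\<phi> (?E i i) \<noteq> 0\<^sub>m ?N ?N"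
      using inj_onD[OF inj _ E zero_in_block_mats] \<phi>_zero by metis
    moreover have "\<phi> (?E i i) * \<phi> (?E i i) = \<phi> (?E i i)"
      using mult[OF E E] i by (simp add: unit_mat_mult)
    ultimately show ?thesis
      unfolding T_def using mat_trace_idempotent[OF carr[OF E]] by metis
  qed
  then obtain r :: "nat \<Rightarrow> nat" where r: "\<And>i. i < ?N \<Longrightarrow> T (?E i i) = of_nat (r i) \<and> r i \<ge> 1"
    by metis
  define D where "D = {p. fst p < ?N \<and> snd p < ?N \<and> fst p div n = snd p div n}"
  have fin: "finite D"
    by (rule finite_subset[of _ "{..<?N} \<times> {..<?N}"]) (auto simp: D_def)
  \<comment> \<open>Truncation of \<open>X\<close> to the positions in \<open>S\<close>. It stays in
    the block algebra for \<open>S\<close> inside \<open>D\<close>, so \<open>T\<close> can be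
    expanded over matrix units by adding one position at a time.\<close>
  define R where "R X S = mat ?N ?N (\<lambda>p. if p \<in> S then X $$ p else 0 :: complex)" for X S
  have R_B: "R X S \<in> ?B" if "S \<subseteq> D" for X S
    using that by (intro block_matsI) (auto simp: R_def D_def)
  have T_R: "T (R X S) = (\<Sum>p\<in>S. X $$ p * T (?E (fst p) (snd p)))" if "S \<subseteq> D" for X S
    using finite_subset[OF that fin] that
  proof (induction S)
    case empty
    have "R X {} = 0\<^sub>m ?N ?N" by (auto simp: R_def)
    then show ?case by (simp add: T_zero)
  next
    case (insert p S)
    have E: "?E (fst p) (snd p) \<in> ?B"
      using insert.prems by (intro unit_mat_in_block_mats) (auto simp: D_def)
    have "R X (insert p S) = R X S + X $$ p \<cdot>\<^sub>m ?E (fst p) (snd p)"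
      using insert.hyps(2) by (intro eq_matI) (auto simp: R_def unit_mat_def)
    then have "T (R X (insert p S)) = T (R X S) + X $$ p * T (?E (fst p) (snd p))"
      using insert.prems by (simp add: T_add R_B smult_in_block_mats T_smult E)
    then show ?case
      using insert by simp
  qed
  have T_diag: "T X = (\<Sum>i<?N. X $$ (i, i) * of_nat (r i))" if X: "X \<in> ?B" for X
  proof -
    have "R X D = X"
      using block_matsD[OF X] by (intro eq_matI) (auto simp: R_def D_def)
    then have "T X = (\<Sum>p\<in>D. X $$ p * T (?E (fst p) (snd p)))"
      using T_R[of D X] by simp
    also have "\<dots> = (\<Sum>p\<in>(\<lambda>i. (i, i)) ` {..<?N}. X $$ p * T (?E (fst p) (snd p)))"
    proof (intro sum.mono_neutral_right fin ballI)
      fix p assume p: "p \<in> D - (\<lambda>i. (i, i)) ` {..<?N}"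
      then have "fst p \<noteq> snd p" by (cases p) (auto simp: D_def)
      with p show "X $$ p * T (?E (fst p) (snd p)) = 0"
        by (simp add: D_def T_off_diag)
    qed (auto simp: D_def)
    also have "\<dots> = (\<Sum>i<?N. X $$ (i, i) * of_nat (r i))"
      using r by (subst sum.reindex) (auto simp: inj_on_def)
    finally show ?thesis .
  qed
  have r1: "r i = 1" if "i < ?N" for i
  proof (rule ccontr)
    assume "r i \<noteq> 1"
    then have "1 < r i"
      using r[OF that] by linarith
    then have "(\<Sum>i<?N. 1) < (\<Sum>i<?N. r i)"
      using r that by (intro sum_strict_mono_ex1) blast+
    moreover have "T (1\<^sub>m ?N) = of_nat ?N"
      unfolding T_def one by (simp add: mat_trace_def)
    then have "(\<Sum>i<?N. of_nat (r i)) = (of_nat ?N :: complex)"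
      using T_diag[OF one_in_block_mats] by simp
    then have "(\<Sum>i<?N. r i) = ?N"
      unfolding of_nat_sum[symmetric] of_nat_eq_iff .
    ultimately show False by simp
  qed
  have T_trace: "T X = mat_trace X" if "X \<in> ?B" for X
    unfolding T_diag[OF that] mat_trace_carrier[OF block_matsD(1)[OF that]] using r1 by simp
  have \<phi>_pow: "\<phi> X ^\<^sub>m k = \<phi> (X ^\<^sub>m k)" for k
  proof (induction k)
    case 0
    have "dim_row (\<phi> X) = ?N" "dim_row X = ?N"
      using carr[OF X] block_matsD(1)[OF X] by blast+
    then show ?case by (simp add: one)
  qed (simp add: mult pow_in_block_mats X)
  show ?thesis
    by (rule det_eq_of_mat_trace_pow_eq[OF carr[OF X] block_matsD(1)[OF X]])
      (simp only: \<phi>_pow T_def[symmetric] T_trace[OF pow_in_block_mats[OF X]])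
qed

section \<open>Kronecker products and unitary matrices\<close>

text \<open>The left factor carries the outer index, so a diagonal left factor makes the product
  block-diagonal with blocks of the size of the right factor. This is why the recursion below adds
  its new factors on the left.\<close>

definition kron :: "complex mat \<Rightarrow> complex mat \<Rightarrow> complex mat" where
  "kron A B = mat (dim_row A * dim_row B) (dim_col A * dim_col B)
     (\<lambda>(i, j). A $$ (i div dim_row B, j div dim_col B) * B $$ (i mod dim_row B, j mod dim_col B))"

lemma kron_carrier: "A \<in> carrier_mat p p \<Longrightarrow> B \<in> carrier_mat q q \<Longrightarrow> kron A B \<in> carrier_mat (p * q) (p * q)"
  by (auto simp: kron_def)

lemma div_mod_less:
  assumes "(i::nat) < p * q"
  shows "i div q < p" "i mod q < q"
  using assms by (simp_all add: less_mult_imp_div_less) (metis mod_less_divisor mult_0_right not_gr_zero not_less0)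

lemma index_kron:
  assumes "A \<in> carrier_mat p p" "B \<in> carrier_mat q q" "i < p * q" "j < p * q"
  shows "kron A B $$ (i, j) = A $$ (i div q, j div q) * B $$ (i mod q, j mod q)"
  using assms by (auto simp: kron_def)

lemma sum_div_mod:
  "(\<Sum>k<p * q. f (k div q) (k mod q)) = (\<Sum>a<p. \<Sum>b<q. f a b)" for p q :: nat
proof -
  have "(\<Sum>a<p. \<Sum>b<q. f a b) = (\<Sum>x\<in>{..<p} \<times> {..<q}. f (fst x) (snd x))"
    by (simp add: sum.cartesian_product split_def)
  also have "\<dots> = (\<Sum>k<p * q. f (k div q) (k mod q))"
  proof (rule sum.reindex_bij_witness[of _ "\<lambda>k. (k div q, k mod q)" "\<lambda>(a, b). a * q + b"])
    fix x assume x: "x \<in> {..<p} \<times> {..<q}"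
    obtain a b where ab: "x = (a, b)" "a < p" "b < q" using x by auto
    then have "a * q + b < Suc a * q" by simp
    also have "\<dots> \<le> p * q" using ab by (intro mult_right_mono) auto
    finally show "(case x of (a, b) \<Rightarrow> a * q + b) \<in> {..<p * q}" using ab by simp
  qed (auto simp: div_mod_less)
  finally show ?thesis by simp
qed

lemma kron_mult:
  assumes "A \<in> carrier_mat p p" "B \<in> carrier_mat q q" "C \<in> carrier_mat p p" "D \<in> carrier_mat q q"
  shows "kron A B * kron C D = kron (A * C) (B * D)"
proof (rule eq_matI)
  note AC = mult_carrier_mat[OF assms(1,3)] and BD = mult_carrier_mat[OF assms(2,4)]
  fix i j assume "i < dim_row (kron (A * C) (B * D))" "j < dim_col (kron (A * C) (B * D))"
  then have ij: "i < p * q" "j < p * q"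
    using kron_carrier[OF AC BD] by auto
  have "(kron A B * kron C D) $$ (i, j)
      = (\<Sum>k<p * q. (A $$ (i div q, k div q) * B $$ (i mod q, k mod q)) * (C $$ (k div q, j div q) * D $$ (k mod q, j mod q)))"
    unfolding index_mult_mat_sum[OF kron_carrier[OF assms(1,2)] kron_carrier[OF assms(3,4)] ij]
    using ij by (intro sum.cong) (simp_all add: index_kron[OF assms(1,2)] index_kron[OF assms(3,4)])
  also have "\<dots> = (\<Sum>a<p. \<Sum>b<q. (A $$ (i div q, a) * B $$ (i mod q, b)) * (C $$ (a, j div q) * D $$ (b, j mod q)))"
    by (rule sum_div_mod)
  also have "\<dots> = (\<Sum>a<p. A $$ (i div q, a) * C $$ (a, j div q)) * (\<Sum>b<q. B $$ (i mod q, b) * D $$ (b, j mod q))"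
    by (simp add: sum_product mult_ac)
  also have "\<dots> = kron (A * C) (B * D) $$ (i, j)"
    unfolding index_kron[OF AC BD ij] using ij
    by (simp only: index_mult_mat_sum[OF assms(1,3)] index_mult_mat_sum[OF assms(2,4)] div_mod_less)
  finally show "(kron A B * kron C D) $$ (i, j) = kron (A * C) (B * D) $$ (i, j)" .
qed (use kron_carrier[OF assms(1,2)] kron_carrier[OF assms(3,4)] assms in \<open>auto simp: kron_def\<close>)

lemma kron_one: "kron (1\<^sub>m p) (1\<^sub>m q) = 1\<^sub>m (p * q)"
proof (rule eq_matI)
  fix i j assume "i < dim_row (1\<^sub>m (p * q))" "j < dim_col (1\<^sub>m (p * q))"
  then have ij: "i < p * q" "j < p * q" by auto
  have "i div q = j div q \<and> i mod q = j mod q \<longleftrightarrow> i = j"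
    by (metis div_mult_mod_eq)
  then show "kron (1\<^sub>m p) (1\<^sub>m q) $$ (i, j) = 1\<^sub>m (p * q) $$ (i, j)"
    using ij by (auto simp: index_kron[of _ p _ q] div_mod_less)
qed (auto simp: kron_def)

lemma kron_smult:
  "kron (c \<cdot>\<^sub>m A) (d \<cdot>\<^sub>m B) = (c * d) \<cdot>\<^sub>m kron A B"
proof (rule eq_matI)
  fix i j assume "i < dim_row ((c * d) \<cdot>\<^sub>m kron A B)" "j < dim_col ((c * d) \<cdot>\<^sub>m kron A B)"
  then show "kron (c \<cdot>\<^sub>m A) (d \<cdot>\<^sub>m B) $$ (i, j) = ((c * d) \<cdot>\<^sub>m kron A B) $$ (i, j)"
    by (auto simp: kron_def div_mod_less)
qed (auto simp: kron_def)

lemma kron_pow: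
  assumes "A \<in> carrier_mat p p" "B \<in> carrier_mat q q"
  shows "kron A B ^\<^sub>m k = kron (A ^\<^sub>m k) (B ^\<^sub>m k)"
proof (induction k)
  case 0
  have "dim_row A = p" "dim_row B = q" "dim_row (kron A B) = p * q"
    using assms kron_carrier[OF assms] by blast+
  then show ?case by (simp add: kron_one)
next
  case (Suc k)
  show ?case
    unfolding pow_mat.simps Suc by (rule kron_mult[OF pow_carrier_mat[OF assms(1)] pow_carrier_mat[OF assms(2)] assms])
qed

text \<open>The phases of the two factors multiply. In every use one factor contributes \<omega> and
  the other commutes, so each relation of the recursion comes from exactly one tensor
  position.\<close>

lemma kron_skew_commute:
  assumes "A \<in> carrier_mat p p" "B \<in> carrier_mat q q" "C \<in> carrier_mat p p" "D \<in> carrier_mat q q"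
    and "A * C = c \<cdot>\<^sub>m (C * A)" "B * D = d \<cdot>\<^sub>m (D * B)"
  shows "kron A B * kron C D = (c * d) \<cdot>\<^sub>m (kron C D * kron A B)"
  unfolding kron_mult[OF assms(1-4)] kron_mult[OF assms(3,4,1,2)] assms(5,6) by (rule kron_smult)

lemma kron_in_block_mats:
  assumes "A \<in> carrier_mat p p" "B \<in> carrier_mat q q"
    and "\<And>i j. i < p \<Longrightarrow> j < p \<Longrightarrow> i \<noteq> j \<Longrightarrow> A $$ (i, j) = 0"
  shows "kron A B \<in> block_mats p q"
  using assms by (intro block_matsI kron_carrier) (auto simp: index_kron div_mod_less)

section \<open>Conjugate transpose and unitary matrices\<close>

definition dagger :: "complex mat \<Rightarrow> complex mat" where
  "dagger A = transpose_mat (map_mat cnj A)"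

lemma dagger_carrier: "A \<in> carrier_mat p q \<Longrightarrow> dagger A \<in> carrier_mat q p"
  by (auto simp: dagger_def)

lemma index_dagger: "A \<in> carrier_mat p q \<Longrightarrow> i < q \<Longrightarrow> j < p \<Longrightarrow> dagger A $$ (i, j) = cnj (A $$ (j, i))"
  by (auto simp: dagger_def)

lemma det_dagger: "A \<in> carrier_mat n n \<Longrightarrow> det (dagger A) = cnj (det A)"
proof -
  assume A: "A \<in> carrier_mat n n"
  interpret comm_ring_hom cnj by unfold_locales auto
  show ?thesis
    unfolding dagger_def using A by (subst det_transpose[of _ n]) auto
qed

lemma dagger_mult:
  assumes "A \<in> carrier_mat p q" "B \<in> carrier_mat q r"
  shows "dagger (A * B) = dagger B * dagger A"
proof (rule eq_matI)
  fix i j assume "i < dim_row (dagger B * dagger A)" "j < dim_col (dagger B * dagger A)"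
  then have ij: "i < r" "j < p" using assms by (auto simp: dagger_def)
  then show "dagger (A * B) $$ (i, j) = (dagger B * dagger A) $$ (i, j)"
    unfolding index_dagger[OF mult_carrier_mat[OF assms] ij] index_mult_mat_sum[OF assms ij(2,1)]
      index_mult_mat_sum[OF dagger_carrier[OF assms(2)] dagger_carrier[OF assms(1)] ij] cnj_sum
    by (intro sum.cong) (simp_all add: index_dagger[OF assms(1)] index_dagger[OF assms(2)])
qed (use assms in \<open>auto simp: dagger_def\<close>)

lemma dagger_kron:
  assumes "A \<in> carrier_mat p p" "B \<in> carrier_mat q q"
  shows "dagger (kron A B) = kron (dagger A) (dagger B)"
proof (rule eq_matI)
  note dc = kron_carrier[OF dagger_carrier[OF assms(1)] dagger_carrier[OF assms(2)]]
  fix i j assume "i < dim_row (kron (dagger A) (dagger B))" "j < dim_col (kron (dagger A) (dagger B))"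
  then have ij: "i < p * q" "j < p * q" using dc by auto
  then show "dagger (kron A B) $$ (i, j) = kron (dagger A) (dagger B) $$ (i, j)"
    by (simp add: index_dagger[OF kron_carrier[OF assms]] index_dagger[OF assms(1)] index_dagger[OF assms(2)]
        index_kron[OF assms] index_kron[OF dagger_carrier[OF assms(1)] dagger_carrier[OF assms(2)]] div_mod_less)
qed (use assms in \<open>auto simp: dagger_def kron_def\<close>)

definition unitary_mat :: "nat \<Rightarrow> complex mat \<Rightarrow> bool" where
  "unitary_mat n A \<longleftrightarrow> A \<in> carrier_mat n n \<and> dagger A * A = 1\<^sub>m n \<and> A * dagger A = 1\<^sub>m n"

lemma unitary_matI:
  assumes "A \<in> carrier_mat n n" "dagger A * A = 1\<^sub>m n"
  shows "unitary_mat n A"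
  using assms mat_mult_left_right_inverse[OF dagger_carrier[OF assms(1)] assms(1)]
  by (simp add: unitary_mat_def)

lemma dagger_one: "dagger (1\<^sub>m n) = 1\<^sub>m n"
  by (auto simp: dagger_def)

lemma unitary_mat_one: "unitary_mat n (1\<^sub>m n)"
  by (simp add: unitary_mat_def dagger_one)

lemma unitary_mat_mult:
  assumes "unitary_mat n A" "unitary_mat n B"
  shows "unitary_mat n (A * B)"
proof (rule unitary_matI)
  have A: "A \<in> carrier_mat n n" "dagger A * A = 1\<^sub>m n" and B: "B \<in> carrier_mat n n" "dagger B * B = 1\<^sub>m n"
    using assms by (auto simp: unitary_mat_def)
  show "A * B \<in> carrier_mat n n" by (rule mult_carrier_mat[OF A(1) B(1)])
  have "dagger (A * B) * (A * B) = dagger B * (dagger A * (A * B))"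
    unfolding dagger_mult[OF A(1) B(1)]
    by (rule assoc_mult_mat[OF dagger_carrier[OF B(1)] dagger_carrier[OF A(1)] mult_carrier_mat[OF A(1) B(1)]])
  also have "dagger A * (A * B) = B"
    unfolding assoc_mult_mat[OF dagger_carrier[OF A(1)] A(1) B(1), symmetric] A(2)
    by (rule left_mult_one_mat[OF B(1)])
  finally show "dagger (A * B) * (A * B) = 1\<^sub>m n" unfolding B(2) .
qed

lemma unitary_mat_kron:
  assumes "unitary_mat p A" "unitary_mat q B"
  shows "unitary_mat (p * q) (kron A B)"
proof (rule unitary_matI)
  have A: "A \<in> carrier_mat p p" "dagger A * A = 1\<^sub>m p" and B: "B \<in> carrier_mat q q" "dagger B * B = 1\<^sub>m q"
    using assms by (auto simp: unitary_mat_def)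
  show "kron A B \<in> carrier_mat (p * q) (p * q)" by (rule kron_carrier[OF A(1) B(1)])
  show "dagger (kron A B) * kron A B = 1\<^sub>m (p * q)"
    unfolding dagger_kron[OF A(1) B(1)] kron_mult[OF dagger_carrier[OF A(1)] dagger_carrier[OF B(1)] A(1) B(1)]
      A(2) B(2) by (rule kron_one)
qed

text \<open>The weighted cyclic shift sending the basis vector j to \<open>f j\<close> times the
  basis vector j + s modulo m. Clock, shift and their product all have this form, which is closed
  under products, so their relations reduce to identities between weights.\<close>

definition wshift :: "nat \<Rightarrow> nat \<Rightarrow> (nat \<Rightarrow> complex) \<Rightarrow> complex mat" where
  "wshift m s f = mat m m (\<lambda>(i, j). if i = (j + s) mod m then f j else 0)"

lemma wshift_carrier [simp]: "wshift m s f \<in> carrier_mat m m"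
  by (simp add: wshift_def)

lemma wshift_cong: "s mod m = t mod m \<Longrightarrow> (\<And>j. j < m \<Longrightarrow> f j = g j) \<Longrightarrow> wshift m s f = wshift m t g"
  by (intro eq_matI) (auto simp: wshift_def intro: mod_add_cong; metis mod_add_right_eq)+

lemma wshift_one: "wshift m 0 (\<lambda>_. 1) = 1\<^sub>m m"
  by (intro eq_matI) (auto simp: wshift_def)

lemma wshift_mult: "wshift m s f * wshift m t g = wshift m (s + t) (\<lambda>j. f ((j + t) mod m) * g j)"
proof (rule eq_matI)
  fix i j assume "i < dim_row (wshift m (s + t) (\<lambda>j. f ((j + t) mod m) * g j))"
    "j < dim_col (wshift m (s + t) (\<lambda>j. f ((j + t) mod m) * g j))"
  then have ij: "i < m" "j < m" by (auto simp: wshift_def)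
  have "(wshift m s f * wshift m t g) $$ (i, j) = (\<Sum>k<m. wshift m s f $$ (i, k) * wshift m t g $$ (k, j))"
    by (rule index_mult_mat_sum[OF wshift_carrier wshift_carrier ij])
  also have "\<dots> = (\<Sum>k<m. if k = (j + t) mod m then (if i = (k + s) mod m then f k else 0) * g j else 0)"
    using ij by (intro sum.cong) (auto simp: wshift_def)
  also have "\<dots> = wshift m (s + t) (\<lambda>j. f ((j + t) mod m) * g j) $$ (i, j)"
    using ij by (auto simp: wshift_def mod_simps ac_simps)
  finally show "(wshift m s f * wshift m t g) $$ (i, j) = wshift m (s + t) (\<lambda>j. f ((j + t) mod m) * g j) $$ (i, j)" .
qed (auto simp: wshift_def)

lemma unitary_mat_wshift:
  assumes "\<And>j. j < m \<Longrightarrow> cnj (f j) * f j = 1"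
  shows "unitary_mat m (wshift m s f)"
proof (rule unitary_matI)
  show "dagger (wshift m s f) * wshift m s f = 1\<^sub>m m"
  proof (rule eq_matI)
    fix i j assume "i < dim_row (1\<^sub>m m)" "j < dim_col (1\<^sub>m m)"
    then have ij: "i < m" "j < m" by auto
    have "(i + s) mod m = (j + s) mod m \<longleftrightarrow> i mod m = j mod m"
      unfolding nat_mod_eq_iff by (simp add: ac_simps)
    then have eq: "(i + s) mod m = (j + s) mod m \<longleftrightarrow> i = j"
      using ij by simp
    have "(dagger (wshift m s f) * wshift m s f) $$ (i, j)
        = (\<Sum>k<m. cnj (wshift m s f $$ (k, i)) * wshift m s f $$ (k, j))"
      unfolding index_mult_mat_sum[OF dagger_carrier[OF wshift_carrier] wshift_carrier ij]
      using ij by (intro sum.cong) (auto simp: index_dagger[OF wshift_carrier])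
    also have "\<dots> = (\<Sum>k<m. if k = (i + s) mod m then (if i = j then cnj (f i) * f i else 0) else 0)"
      using ij eq by (intro sum.cong) (auto simp: wshift_def)
    also have "\<dots> = 1\<^sub>m m $$ (i, j)"
      using ij assms by auto
    finally show "(dagger (wshift m s f) * wshift m s f) $$ (i, j) = 1\<^sub>m m $$ (i, j)" .
  qed (auto simp: dagger_def wshift_def)
qed simp

section \<open>Unitary matrices for the generators\<close>

lemma gca_omega_power: "m > 0 \<Longrightarrow> gca_omega m ^ m = 1"
  by (simp add: gca_omega_def exp_of_nat_mult[symmetric])

lemma gca_omega_mod: "m > 0 \<Longrightarrow> gca_omega m ^ (k mod m) = gca_omega m ^ k"
proof -
  assume "m > 0"
  have "gca_omega m ^ k = gca_omega m ^ (m * (k div m) + k mod m)" by simp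
  also have "\<dots> = gca_omega m ^ (k mod m)"
    using \<open>m > 0\<close> by (simp only: power_add power_mult gca_omega_power power_one mult_1_left)
  finally show ?thesis ..
qed

lemma norm_gca_omega: "norm (gca_omega m) = 1"
  by (simp add: gca_omega_def norm_exp_eq_Re)

lemma cnj_mult_self: "norm z = 1 \<Longrightarrow> cnj z * z = 1"
  by (metis complex_norm_square mult.commute of_real_1 one_power2)

text \<open>Primitivity of \<omega>, from the enumeration of the m-th roots of unity. This recovers
  exponents below m from phases.\<close>

lemma gca_omega_power_inj:
  assumes "gca_omega m ^ a = gca_omega m ^ b" "a < m" "b < m"
  shows "a = b"
proof -
  have pow: "gca_omega m ^ k = cis (2 * pi * real k / real m)" for k
  proof -
    have "gca_omega m = cis (2 * pi / real m)"
      by (simp add: gca_omega_def cis_conv_exp mult_ac)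
    then show ?thesis by (simp add: DeMoivre mult_ac)
  qed
  have "inj_on (\<lambda>k. cis (2 * pi * real k / real m)) {..<m}"
    using Complex.bij_betw_roots_unity[of m] assms by (auto simp: bij_betw_def)
  then show ?thesis
    using assms by (auto simp: pow inj_on_def)
qed

section \<open>Clock and shift matrices\<close>

definition clock :: "nat \<Rightarrow> complex mat" where
  "clock m = wshift m 0 (\<lambda>j. gca_omega m ^ j)"

definition shift :: "nat \<Rightarrow> complex mat" where
  "shift m = wshift m 1 (\<lambda>_. 1)"

text \<open>The scalar makes the m-th power of the product of clock and shift equal to 1.\<close>

definition clock_shift :: "nat \<Rightarrow> complex mat" where
  "clock_shift m = wshift m 1 (\<lambda>j. inverse (exp (of_real pi * \<i> / of_nat m)) ^ (m + 1) * gca_omega m ^ (j + 1))"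

lemma clock_carrier [simp]: "clock m \<in> carrier_mat m m"
  and shift_carrier [simp]: "shift m \<in> carrier_mat m m"
  and clock_shift_carrier [simp]: "clock_shift m \<in> carrier_mat m m"
  by (simp_all add: clock_def shift_def clock_shift_def)

lemma unitary_clock: "unitary_mat m (clock m)"
  and unitary_shift: "unitary_mat m (shift m)"
  and unitary_clock_shift: "unitary_mat m (clock_shift m)"
  unfolding clock_def shift_def clock_shift_def
  by (rule unitary_mat_wshift, rule cnj_mult_self,
      simp add: norm_mult norm_power norm_inverse norm_gca_omega norm_exp_eq_Re)+

lemma wshift_smult: "c \<cdot>\<^sub>m wshift m s f = wshift m s (\<lambda>j. c * f j)"
  by (intro eq_matI) (auto simp: wshift_def)

text \<open>In the order clock, clock times shift, shift, each matrix passes every later one with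
  the same factor \<omega>. The first two can thus serve as a new pair of generators and the third
  as the new factor of the grading.\<close>

lemma clock_skew_commute:
  assumes "m > 0"
  shows "clock m * shift m = gca_omega m \<cdot>\<^sub>m (shift m * clock m)"
    and "clock m * clock_shift m = gca_omega m \<cdot>\<^sub>m (clock_shift m * clock m)"
    and "clock_shift m * shift m = gca_omega m \<cdot>\<^sub>m (shift m * clock_shift m)"
  unfolding clock_def shift_def clock_shift_def wshift_mult wshift_smult
  using assms by (auto intro!: wshift_cong simp: gca_omega_mod power_add)

lemma wshift_pow:
  assumes "\<And>k. wshift m (s * k) (F k) * wshift m s f = wshift m (s * Suc k) (F (Suc k))" "\<And>j. j < m \<Longrightarrow> F 0 j = 1"
  shows "wshift m s f ^\<^sub>m k = wshift m (s * k) (F k)"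
proof (induction k)
  case 0
  have "wshift m 0 (F 0) = 1\<^sub>m m"
    using assms(2) by (subst wshift_one[symmetric]) (rule wshift_cong, auto)
  then show ?case by (simp add: wshift_def)
qed (simp add: assms(1))

lemma clock_pow:
  assumes "m > 0"
  shows "clock m ^\<^sub>m m = 1\<^sub>m m"
proof -
  have "clock m ^\<^sub>m m = wshift m (0 * m) (\<lambda>j. gca_omega m ^ (j * m))"
    unfolding clock_def using assms
    by (intro wshift_pow) (auto simp: wshift_mult gca_omega_mod power_add power_mult intro!: wshift_cong)
  also have "\<dots> = wshift m 0 (\<lambda>_. 1)"
    using assms by (intro wshift_cong) (auto simp: mult.commute[of _ m] power_mult gca_omega_power)
  finally show ?thesis by (simp only: wshift_one)
qed

lemma shift_pow: "shift m ^\<^sub>m m = 1\<^sub>m m"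
proof -
  have "shift m ^\<^sub>m m = wshift m (1 * m) (\<lambda>_. 1)"
    unfolding shift_def by (intro wshift_pow) (auto simp: wshift_mult)
  also have "\<dots> = wshift m 0 (\<lambda>_. 1)"
    by (intro wshift_cong) auto
  finally show ?thesis by (simp only: wshift_one)
qed

text \<open>Going once around the cycle multiplies the weights to \<omega> to the power 1 + ... + m,
  which is -1 for even m. With z the square root exp (\<pi> i / m) of \<omega>, this is z to the
  power m (m + 1), so each of the m factors must carry the inverse of z to the power m + 1.\<close>

lemma clock_shift_pow:
  assumes "m > 0"
  shows "clock_shift m ^\<^sub>m m = 1\<^sub>m m"
proof -
  let ?w = "gca_omega m"
  define z where "z = exp (of_real pi * \<i> / of_nat m :: complex)"
  define S where "S k = \<Sum>{..k::nat}" for k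
  have w: "?w = z ^ 2"
    by (simp add: z_def gca_omega_def exp_of_nat_mult[symmetric] mult.assoc)
  \<comment> \<open>Weight of the k-th power at column j: the clock part collects the exponents (j +
    1) + ... + (j + k) = j k + S k.\<close>
  define F where "F k j = inverse z ^ ((m + 1) * k) * ?w ^ (j * k + S k)" for k j
  define f where "f j = inverse z ^ (m + 1) * ?w ^ (j + 1)" for j
  have step: "F k ((j + 1) mod m) * f j = F (Suc k) j" for k j
  proof -
    have "?w ^ ((j + 1) mod m * k + S k) = ?w ^ ((j + 1) * k + S k)"
      using assms by (simp only: power_add power_mult gca_omega_mod)
    then have "F k ((j + 1) mod m) * f j
        = (inverse z ^ ((m + 1) * k) * inverse z ^ (m + 1)) * (?w ^ ((j + 1) * k + S k) * ?w ^ (j + 1))"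
      unfolding F_def f_def by (simp only: mult_ac)
    also have "\<dots> = F (Suc k) j"
    proof -
      have "(m + 1) * k + (m + 1) = (m + 1) * Suc k" "(j + 1) * k + S k + (j + 1) = j * Suc k + S (Suc k)"
        by (simp_all add: S_def algebra_simps)
      then show ?thesis
        unfolding F_def power_add[symmetric] by presburger
    qed
    finally show ?thesis .
  qed
  have "clock_shift m = wshift m 1 f"
    unfolding clock_shift_def f_def[abs_def] z_def ..
  also have "wshift m 1 f ^\<^sub>m m = wshift m (1 * m) (F m)"
  proof (rule wshift_pow)
    show "wshift m (1 * k) (F k) * wshift m 1 f = wshift m (1 * Suc k) (F (Suc k))" for k
      unfolding wshift_mult step by simp
  qed (simp add: F_def S_def)
  also have "\<dots> = wshift m 0 (\<lambda>_. 1)"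
  proof (rule wshift_cong)
    fix j
    \<comment> \<open>Only the doubled sum is needed, because \<omega> is the square of z.\<close>
    have "2 * \<Sum>{..n::nat} = (n + 1) * n" for n
      by (induction n) auto
    then have S: "2 * S m = (m + 1) * m"
      by (simp only: S_def)
    have "?w ^ (j * m + S m) = ?w ^ S m"
      using assms by (simp only: power_add mult.commute[of j] power_mult gca_omega_power power_one mult_1_left)
    also have "\<dots> = z ^ ((m + 1) * m)"
      unfolding w power_mult[symmetric] S ..
    finally have "F m j = inverse z ^ ((m + 1) * m) * z ^ ((m + 1) * m)"
      unfolding F_def by simp
    also have "\<dots> = (inverse z * z) ^ ((m + 1) * m)"
      by (rule power_mult_distrib[symmetric])
    finally show "F m j = 1"
      by (simp add: z_def)
  qed simp
  finally show ?thesis by (simp only: wshift_one)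
qed

text \<open>
  Jordan--Wigner recursion: the grading operator skew-commutes with all generators built so far, so it
  serves as the second tensor factor of the two new ones.
\<close>

primrec gca_grading :: "nat \<Rightarrow> nat \<Rightarrow> complex mat" where
  "gca_grading m 0 = 1\<^sub>m 1"
| "gca_grading m (Suc P) = kron (shift m) (gca_grading m P)"

primrec gen_mat :: "nat \<Rightarrow> nat \<Rightarrow> nat \<Rightarrow> complex mat" where
  "gen_mat m 0 j = 1\<^sub>m 1"
| "gen_mat m (Suc P) j =
     (if j \<le> 2 * P then kron (1\<^sub>m m) (gen_mat m P j)
      else if j = 2 * P + 1 then kron (clock m) (gca_grading m P)
      else kron (clock_shift m) (gca_grading m P))"

lemma unitary_gca_grading: "unitary_mat (m ^ P) (gca_grading m P)"
  by (induction P) (auto intro: unitary_mat_kron unitary_shift unitary_mat_one)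

text \<open>Indices outside 1..2P receive unitary values as well: 0 gives the identity, and the last
  branch of \<open>gen_mat\<close> catches everything above its bound. Words over arbitrary letters
  are therefore unitary.\<close>

lemma unitary_gen_mat: "unitary_mat (m ^ P) (gen_mat m P j)"
  by (induction P)
    (auto intro: unitary_mat_kron unitary_clock unitary_clock_shift unitary_mat_one unitary_gca_grading)

lemma gca_grading_carrier [simp]: "gca_grading m P \<in> carrier_mat (m ^ P) (m ^ P)"
  using unitary_gca_grading by (simp add: unitary_mat_def)

lemma gen_mat_carrier [simp]: "gen_mat m P j \<in> carrier_mat (m ^ P) (m ^ P)"
  using unitary_gen_mat by (simp add: unitary_mat_def)

lemma one_mat_pow: "1\<^sub>m n ^\<^sub>m k = (1\<^sub>m n :: complex mat)"
  by (induction k) auto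

lemma gca_grading_pow: "gca_grading m P ^\<^sub>m m = 1\<^sub>m (m ^ P)"
  by (induction P) (simp_all add: one_mat_pow kron_pow[OF shift_carrier gca_grading_carrier] shift_pow kron_one)

lemma gen_mat_pow: "m > 0 \<Longrightarrow> gen_mat m P j ^\<^sub>m m = 1\<^sub>m (m ^ P)"
  by (induction P)
    (simp_all add: one_mat_pow kron_pow[OF one_carrier_mat gen_mat_carrier] kron_one
      kron_pow[OF clock_carrier gca_grading_carrier] kron_pow[OF clock_shift_carrier gca_grading_carrier]
      clock_pow clock_shift_pow gca_grading_pow)

lemma one_mat_skew_commute:
  "A \<in> carrier_mat n n \<Longrightarrow> 1\<^sub>m n * A = 1 \<cdot>\<^sub>m (A * 1\<^sub>m n :: complex mat)"
  unfolding left_mult_one_mat right_mult_one_mat by (intro eq_matI) auto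

lemma gen_mat_skew_grading:
  assumes "m > 0" "1 \<le> j" "j \<le> 2 * P"
  shows "gen_mat m P j * gca_grading m P = gca_omega m \<cdot>\<^sub>m (gca_grading m P * gen_mat m P j)"
  using assms
proof (induction P)
  case (Suc P)
  have G: "gca_grading m P * gca_grading m P = 1 \<cdot>\<^sub>m (gca_grading m P * gca_grading m P)"
    by (intro eq_matI) auto
  have "j \<le> 2 * P \<or> j = 2 * P + 1 \<or> j = 2 * P + 2"
    using Suc.prems by auto
  then consider "j \<le> 2 * P" | "j = 2 * P + 1" | "j = 2 * P + 2" by blast
  then show ?case
  proof cases
    case 1
    then show ?thesis
      using kron_skew_commute[of _ m _ "m ^ P", OF _ _ _ _ one_mat_skew_commute[OF shift_carrier] Suc.IH] Suc.prems by simp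
  next
    case 2
    then show ?thesis
      using kron_skew_commute[of _ m _ "m ^ P", OF _ _ _ _ clock_skew_commute(1)[OF assms(1)] G] by simp
  next
    case 3
    then show ?thesis
      using kron_skew_commute[of _ m _ "m ^ P", OF _ _ _ _ clock_skew_commute(3)[OF assms(1)] G] by simp
  qed
qed simp

text \<open>For two old generators the phase is inherited; for an old one against a new one it
  arises in the right factor, where the grading stands; for the two new ones it arises in the left
  factor.\<close>

lemma gen_mat_skew_commute:
  assumes "m > 0" "1 \<le> k" "k < l" "l \<le> 2 * P"
  shows "gen_mat m P k * gen_mat m P l = gca_omega m \<cdot>\<^sub>m (gen_mat m P l * gen_mat m P k)"
  using assms
proof (induction P)
  case (Suc P)
  have G: "gca_grading m P * gca_grading m P = 1 \<cdot>\<^sub>m (gca_grading m P * gca_grading m P)"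
    by (intro eq_matI) auto
  have "l \<le> 2 * P \<or> k \<le> 2 * P \<and> l = 2 * P + 1 \<or> k \<le> 2 * P \<and> l = 2 * P + 2
      \<or> k = 2 * P + 1 \<and> l = 2 * P + 2"
    using Suc.prems by auto
  then consider "l \<le> 2 * P" | "k \<le> 2 * P" "l = 2 * P + 1" | "k \<le> 2 * P" "l = 2 * P + 2"
    | "k = 2 * P + 1" "l = 2 * P + 2"
    by blast
  then show ?case
  proof cases
    case 1
    then show ?thesis
      using kron_skew_commute[of _ m _ "m ^ P", OF _ _ _ _ one_mat_skew_commute[OF one_carrier_mat] Suc.IH] Suc.prems by simp
  next
    case 2
    then show ?thesis
      using kron_skew_commute[of _ m _ "m ^ P", OF _ _ _ _ one_mat_skew_commute[OF clock_carrier] gen_mat_skew_grading[of m k P]] Suc.prems by simp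
  next
    case 3
    then show ?thesis
      using kron_skew_commute[of _ m _ "m ^ P", OF _ _ _ _ one_mat_skew_commute[OF clock_shift_carrier] gen_mat_skew_grading[of m k P]] Suc.prems by simp
  next
    case 4
    then show ?thesis
      using kron_skew_commute[of _ m _ "m ^ P", OF _ _ _ _ clock_skew_commute(2)[OF assms(1)] G] by simp
  qed
qed simp

text \<open>Up to index 2P + 1 the left factor is the identity or the clock matrix, both diagonal.
  Only generator 2P + 2, which does not occur when \<open>d\<close> = 2P + 1, carries
  \<open>clock_shift\<close>, which moves the blocks cyclically.\<close>

lemma gen_mat_in_block_mats:
  assumes "j \<le> 2 * P + 1"
  shows "gen_mat m (Suc P) j \<in> block_mats m (m ^ P)"
  using assms by (auto intro!: kron_in_block_mats simp: clock_def wshift_def)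

section \<open>Independence of the monomials\<close>

text \<open>The phase picked up when generator l moves from the left of generator k to its right;
  for k < l the defining relation is read backwards.\<close>

definition skew :: "nat \<Rightarrow> nat \<Rightarrow> nat \<Rightarrow> complex" where
  "skew m l k = (if l < k then gca_omega m else if k < l then inverse (gca_omega m) else 1)"

lemma norm_skew: "norm (skew m l k) = 1"
  by (simp add: skew_def norm_inverse norm_gca_omega)

lemma gca_omega_nonzero [simp]: "gca_omega m \<noteq> 0"
  by (simp add: gca_omega_def)

lemma smult_smult_mat: "a \<cdot>\<^sub>m (b \<cdot>\<^sub>m A) = (a * b) \<cdot>\<^sub>m (A :: complex mat)"
  by (intro eq_matI) auto

lemma gen_mat_skew:
  assumes "m > 0" "l \<in> {1..2 * P}" "k \<in> {1..2 * P}"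
  shows "gen_mat m P l * gen_mat m P k = skew m l k \<cdot>\<^sub>m (gen_mat m P k * gen_mat m P l)"
proof -
  have one: "1 \<cdot>\<^sub>m A = A" for A :: "complex mat" by (intro eq_matI) auto
  consider "l < k" | "l = k" | "k < l" by linarith
  then show ?thesis
  proof cases
    case 1
    then show ?thesis using assms gen_mat_skew_commute[of m l k P] by (simp add: skew_def)
  next
    case 2
    then show ?thesis by (simp add: skew_def one)
  next
    case 3
    then show ?thesis
      using assms gen_mat_skew_commute[of m k l P] by (simp add: skew_def smult_smult_mat one)
  qed
qed

primrec word_mat :: "nat \<Rightarrow> nat \<Rightarrow> nat list \<Rightarrow> complex mat" where
  "word_mat m P [] = 1\<^sub>m (m ^ P)"
| "word_mat m P (x # w) = gen_mat m P x * word_mat m P w"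

lemma unitary_word_mat: "unitary_mat (m ^ P) (word_mat m P w)"
  by (induction w) (auto intro: unitary_mat_one unitary_mat_mult unitary_gen_mat)

lemma word_mat_carrier [simp]: "word_mat m P w \<in> carrier_mat (m ^ P) (m ^ P)"
  using unitary_word_mat by (simp add: unitary_mat_def)

lemma word_mat_append: "word_mat m P (u @ v) = word_mat m P u * word_mat m P v"
proof (induction u)
  case Nil
  show ?case using left_mult_one_mat[OF word_mat_carrier] by simp
next
  case (Cons x u)
  then show ?case
    using assoc_mult_mat[OF gen_mat_carrier word_mat_carrier word_mat_carrier] by simp
qed

lemma word_mat_replicate: "word_mat m P (replicate n x) = gen_mat m P x ^\<^sub>m n"
proof (induction n)
  case 0
  have "dim_row (gen_mat m P x) = m ^ P" using gen_mat_carrier by blast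
  then show ?case by simp
next
  case (Suc n)
  have "gen_mat m P x ^\<^sub>m n * gen_mat m P x = word_mat m P (replicate n x @ [x])"
    unfolding word_mat_append Suc using right_mult_one_mat[OF gen_mat_carrier] by simp
  then show ?case by (simp add: replicate_append_same)
qed

definition skew_word :: "nat \<Rightarrow> nat \<Rightarrow> nat list \<Rightarrow> complex" where
  "skew_word m l w = prod_list (map (skew m l) w)"

lemma norm_skew_word: "norm (skew_word m l w) = 1"
  by (induction w) (simp_all add: skew_word_def norm_mult norm_skew)

lemma gen_mat_skew_word:
  assumes "m > 0" "l \<in> {1..2 * P}" "set w \<subseteq> {1..2 * P}"
  shows "gen_mat m P l * word_mat m P w = skew_word m l w \<cdot>\<^sub>m (word_mat m P w * gen_mat m P l)"
  using assms(3)
proof (induction w)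
  case Nil
  show ?case
    unfolding skew_word_def using left_mult_one_mat[OF gen_mat_carrier] right_mult_one_mat[OF gen_mat_carrier]
    by (auto intro!: eq_matI)
next
  case (Cons k w)
  let ?g = "gen_mat m P" and ?w = "word_mat m P w"
  have k: "k \<in> {1..2 * P}" and IH: "?g l * ?w = skew_word m l w \<cdot>\<^sub>m (?w * ?g l)"
    using Cons by auto
  note assoc = assoc_mult_mat[of _ "m ^ P" "m ^ P" _ "m ^ P" _ "m ^ P"]
  have "?g l * (?g k * ?w) = (?g l * ?g k) * ?w"
    by (simp add: assoc)
  also have "\<dots> = skew m l k \<cdot>\<^sub>m ((?g k * ?g l) * ?w)"
    unfolding gen_mat_skew[OF assms(1,2) k]
    by (rule mult_smult_assoc_mat[OF mult_carrier_mat[OF gen_mat_carrier gen_mat_carrier] word_mat_carrier])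
  also have "(?g k * ?g l) * ?w = ?g k * (?g l * ?w)"
    by (simp add: assoc)
  also have "\<dots> = skew_word m l w \<cdot>\<^sub>m (?g k * (?w * ?g l))"
    unfolding IH by (rule mult_smult_distrib[OF gen_mat_carrier mult_carrier_mat[OF word_mat_carrier gen_mat_carrier]])
  also have "?g k * (?w * ?g l) = (?g k * ?w) * ?g l"
    by (simp add: assoc)
  finally show ?case
    by (simp add: smult_smult_mat skew_word_def)
qed

lemma mat_trace_smult: "A \<in> carrier_mat n n \<Longrightarrow> mat_trace (c \<cdot>\<^sub>m A) = c * mat_trace (A :: complex mat)"
  by (auto simp: mat_trace_def sum_distrib_left)

text \<open>Conjugation by the unitary matrix of generator l preserves the trace but multiplies U* V
  by the conjugate of the phase of u times the phase of v. Both phases have modulus 1 and differ, so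
  this factor is not 1 and the trace must vanish.\<close>

lemma mat_trace_word_mat_orthogonal:
  assumes "m > 0" "l \<in> {1..2 * P}" "set u \<subseteq> {1..2 * P}" "set v \<subseteq> {1..2 * P}"
    and "skew_word m l u \<noteq> skew_word m l v"
  shows "mat_trace (dagger (word_mat m P u) * word_mat m P v) = 0"
proof -
  let ?N = "m ^ P"
  let ?g = "gen_mat m P l" and ?U = "word_mat m P u" and ?V = "word_mat m P v"
  let ?a = "skew_word m l u" and ?b = "skew_word m l v"
  note c [simp] = mult_carrier_mat[of _ ?N ?N _ ?N] dagger_carrier[of _ ?N ?N]
  note assoc = assoc_mult_mat[of _ ?N ?N _ ?N _ ?N]
  have g: "dagger ?g * ?g = 1\<^sub>m ?N" "?g * dagger ?g = 1\<^sub>m ?N"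
    using unitary_gen_mat by (auto simp: unitary_mat_def)
  have lone: "1\<^sub>m ?N * A = A" if "A \<in> carrier_mat ?N ?N" for A :: "complex mat"
    using that by simp
  have "dagger ?U * ?V = dagger ?U * (dagger ?g * ?g * ?V)"
    by (simp only: g left_mult_one_mat[OF word_mat_carrier])
  also have "\<dots> = dagger ?U * dagger ?g * (?g * ?V)"
    by (simp add: assoc)
  also have "\<dots> = dagger (?g * ?U) * (?g * ?V)"
    by (simp add: dagger_mult[of _ ?N ?N _ ?N])
  also have "\<dots> = dagger (?a \<cdot>\<^sub>m (?U * ?g)) * (?b \<cdot>\<^sub>m (?V * ?g))"
    by (simp only: gen_mat_skew_word[OF assms(1,2,3)] gen_mat_skew_word[OF assms(1,2,4)])
  also have "dagger (?a \<cdot>\<^sub>m (?U * ?g)) = cnj ?a \<cdot>\<^sub>m dagger (?U * ?g)"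
    by (auto simp: dagger_def intro!: eq_matI)
  also have "(cnj ?a \<cdot>\<^sub>m dagger (?U * ?g)) * (?b \<cdot>\<^sub>m (?V * ?g))
      = (cnj ?a * ?b) \<cdot>\<^sub>m (dagger (?U * ?g) * (?V * ?g))"
    by (simp add: mult_smult_assoc_mat[of _ ?N ?N _ ?N] mult_smult_distrib[of _ ?N ?N _ ?N] smult_smult_mat mult.commute)
  also have "dagger (?U * ?g) * (?V * ?g) = dagger ?g * ((dagger ?U * ?V) * ?g)"
    by (simp add: dagger_mult[of _ ?N ?N _ ?N] assoc)
  finally have "mat_trace (dagger ?U * ?V) = mat_trace ((cnj ?a * ?b) \<cdot>\<^sub>m (dagger ?g * ((dagger ?U * ?V) * ?g)))"
    by (rule arg_cong)
  also have "\<dots> = cnj ?a * ?b * mat_trace (dagger ?g * ((dagger ?U * ?V) * ?g))"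
    by (rule mat_trace_smult[of _ ?N]) simp
  also have "mat_trace (dagger ?g * ((dagger ?U * ?V) * ?g)) = mat_trace (((dagger ?U * ?V) * ?g) * dagger ?g)"
    by (rule mat_trace_comm[of _ ?N ?N]) simp_all
  also have "((dagger ?U * ?V) * ?g) * dagger ?g = dagger ?U * ?V"
    by (simp add: assoc g right_mult_one_mat[OF word_mat_carrier])
  finally have "mat_trace (dagger ?U * ?V) = 0 \<or> cnj ?a * ?b = 1"
    by simp
  moreover have "cnj ?a * ?b \<noteq> 1"
  proof
    assume "cnj ?a * ?b = 1"
    then have "?a * (cnj ?a * ?b) = ?a" by simp
    also have "?a * (cnj ?a * ?b) = (cnj ?a * ?a) * ?b" by simp
    also have "\<dots> = ?b" by (simp add: cnj_mult_self norm_skew_word)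
    finally show False using assms(5) by simp
  qed
  ultimately show ?thesis by blast
qed

text \<open>Comparing the conditions at l and l + 1 gives z_l z_(l+1) = 1, so leading factors cancel
  in pairs. The condition at l = 2P says that the first 2P - 1 factors multiply to 1; an odd number
  of factors then leaves z_(2P-1) = 1, which spreads to all neighbours. Evenness is essential: with
  a single index the condition would be vacuous.\<close>

lemma balanced_products_trivial:
  fixes z :: "nat \<Rightarrow> 'a::field"
  assumes nz: "\<And>k. z k \<noteq> 0"
    and bal: "\<And>l. l \<in> {1..2 * P} \<Longrightarrow> prod z {l<..2 * P} = prod z {1..<l}"
    and k: "k \<in> {1..2 * P}"
  shows "z k = 1"
proof -
  have pair: "z l * z (Suc l) = 1" if l: "1 \<le> l" "l < 2 * P" for l
  proof -
    have "prod z {1..<l} = prod z {l<..2 * P}"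
      using bal[of l] l by simp
    also have "{l<..2 * P} = insert (Suc l) {Suc l<..2 * P}"
      using l by auto
    also have "prod z \<dots> = z (Suc l) * prod z {Suc l<..2 * P}"
      by simp
    also have "prod z {Suc l<..2 * P} = prod z {1..<Suc l}"
      using bal[of "Suc l"] l by simp
    also have "\<dots> = prod z {1..<l} * z l"
      using l by (simp add: prod.atLeastLessThan_Suc)
    finally have "prod z {1..<l} * 1 = prod z {1..<l} * (z l * z (Suc l))"
      by (simp add: mult_ac)
    moreover have "prod z {1..<l} \<noteq> 0" using nz by simp
    ultimately show ?thesis by simp
  qed
  have odd: "prod z {1..<2 * n + 1} = 1" if "n < P" for n
    using that
  proof (induction n)
    case (Suc n)
    have "{1..<2 * Suc n + 1} = insert (2 * n + 1) (insert (2 * n + 2) {1..<2 * n + 1})" by auto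
    then show ?case
      using Suc pair[of "2 * n + 1"] by (simp add: mult.assoc[symmetric])
  qed simp
  have "P \<ge> 1" using k by simp
  then obtain Q where Q: "P = Suc Q" by (cases P) auto
  \<comment> \<open>At the top index the upper product is empty.\<close>
  have "prod z {1..<2 * P} = prod z {2 * P<..2 * P}"
    using bal[of "2 * P"] Q by simp
  also have "{2 * P<..2 * P} = {}" by simp
  finally have "prod z {1..<2 * P} = 1" by simp
  moreover have "{1..<2 * P} = insert (2 * Q + 1) {1..<2 * Q + 1}" using Q by auto
  ultimately have last: "z (2 * Q + 1) = 1"
    using odd[of Q] Q by simp
  \<comment> \<open>Counting downwards reaches the indices 1 to 2Q + 1; the remaining index 2Q + 2
    is treated separately below.\<close>
  have down: "z (2 * Q + 1 - i) = 1" if "i \<le> 2 * Q" for i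
    using that
  proof (induction i)
    case (Suc i)
    then show ?case
      using pair[of "2 * Q + 1 - Suc i"] Q by (simp add: Suc_diff_le)
  qed (use last in simp)
  show ?thesis
  proof (cases "k = 2 * Q + 2")
    case True
    then show ?thesis using pair[of "2 * Q + 1"] last Q by simp
  next
    case False
    then have "2 * Q + 1 - k \<le> 2 * Q" "2 * Q + 1 - (2 * Q + 1 - k) = k"
      using k Q by auto
    then show ?thesis using down by metis
  qed
qed

section \<open>Monomials separated by their phases\<close>

definition monom_word :: "nat \<Rightarrow> (nat \<Rightarrow> nat) \<Rightarrow> nat list" where
  "monom_word d J = concat (map (\<lambda>k. replicate (J k) k) [1..<Suc d])"

lemma set_monom_word: "set (monom_word d J) \<subseteq> {1..d}"
  by (auto simp: monom_word_def)

lemma skew_word_monom_word: "skew_word m l (monom_word d J) = (\<Prod>k\<in>{1..d}. skew m l k ^ J k)"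
proof -
  have "skew_word m l (concat (map (\<lambda>k. replicate (J k) k) ks)) = prod_list (map (\<lambda>k. skew m l k ^ J k) ks)" for ks
    by (induction ks) (simp_all add: skew_word_def map_replicate_const[symmetric] prod_list_replicate)
  then show ?thesis
    by (simp add: monom_word_def prod.distinct_set_conv_list[symmetric] atLeastLessThanSuc_atLeastAtMost
        del: upt_Suc)
qed

text \<open>Dividing the phases of the two monomials turns their equality into the balance condition
  of \<open>balanced_products_trivial\<close>. The test generators range over 1..2P and not just
  1..d: for odd \<open>d\<close> a central monomial is distinguished only by the additional
  generator.\<close>

lemma skew_monom_word_separates:
  assumes J: "J \<in> gca_indices m d" and K: "K \<in> gca_indices m d" and d: "d \<le> 2 * P"
    and eq: "\<And>l. l \<in> {1..2 * P} \<Longrightarrow> skew_word m l (monom_word d J) = skew_word m l (monom_word d K)"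
  shows "J = K"
proof (rule PiE_ext[OF J[unfolded gca_indices_def] K[unfolded gca_indices_def]])
  fix k assume k: "k \<in> {1..d}"
  let ?w = "gca_omega m"
  \<comment> \<open>A quotient of powers, since the difference of the exponents may be negative. The
    value 1 beyond \<open>d\<close> extends the family to the even range 1..2P without changing any
    product.\<close>
  define z where "z k = (if k \<in> {1..d} then ?w ^ J k / ?w ^ K k else 1)" for k
  have "z k = 1"
  proof (rule balanced_products_trivial[of z P k])
    show "z k \<noteq> 0" for k by (simp add: z_def)
    fix l assume l: "l \<in> {1..2 * P}"
    have "(\<Prod>k\<in>{1..d}. skew m l k ^ J k / skew m l k ^ K k) = 1"
      using eq[OF l] by (simp add: skew_word_monom_word prod_dividef skew_def)
    moreover have "(\<Prod>k\<in>{1..d}. skew m l k ^ J k / skew m l k ^ K k)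
        = (\<Prod>k\<in>{1..2 * P}. if l < k then z k else if k < l then inverse (z k) else 1)"
      using d by (intro prod.mono_neutral_cong_left) (auto simp: z_def skew_def power_inverse field_simps)
    moreover have "\<dots> = (\<Prod>k\<in>{1..2 * P}. if l < k then z k else 1) * (\<Prod>k\<in>{1..2 * P}. if k < l then inverse (z k) else 1)"
      unfolding prod.distrib[symmetric] by (intro prod.cong) auto
    moreover have "(\<Prod>k\<in>{1..2 * P}. if l < k then z k else 1) = prod z {l<..2 * P}"
      using l by (subst prod.inter_filter[symmetric]) (auto intro!: prod.cong)
    moreover have "(\<Prod>k\<in>{1..2 * P}. if k < l then inverse (z k) else 1) = (\<Prod>k\<in>{1..<l}. inverse (z k))"
      using l by (subst prod.inter_filter[symmetric]) (auto intro!: prod.cong)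
    moreover have "\<dots> = inverse (prod z {1..<l})"
      using prod_inversef[of z "{1..<l}"] by (simp add: comp_def)
    ultimately have "prod z {l<..2 * P} * inverse (prod z {1..<l}) = 1" by simp
    moreover have "prod z {1..<l} \<noteq> 0" by (simp add: z_def)
    ultimately show "prod z {l<..2 * P} = prod z {1..<l}" by (simp add: field_simps)
  qed (use k d in auto)
  then have "?w ^ J k = ?w ^ K k" using k by (simp add: z_def)
  then show "J k = K k"
    by (rule gca_omega_power_inj) (use J K k in \<open>auto simp: gca_indices_def PiE_iff\<close>)
qed

text \<open>Multiplying the vanishing entries by the conjugate entries of the K-th matrix and
  summing gives the trace pairing with that matrix. Orthogonality leaves only u K times m ^ P, the
  trace of the identity.\<close>

lemma monom_mats_independent:
  assumes "m > 0" "d \<le> 2 * P"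
    and zero: "\<And>i j. i < m ^ P \<Longrightarrow> j < m ^ P \<Longrightarrow>
      (\<Sum>J\<in>gca_indices m d. u J * word_mat m P (monom_word d J) $$ (i, j)) = 0"
    and K: "K \<in> gca_indices m d"
  shows "u K = 0"
proof -
  let ?N = "m ^ P"
  define W where "W J = word_mat m P (monom_word d J)" for J
  have W: "W J \<in> carrier_mat ?N ?N" for J by (simp add: W_def)
  define t where "t J = mat_trace (dagger (W K) * W J)" for J
  have t: "t J = (\<Sum>i<?N. \<Sum>k<?N. cnj (W K $$ (k, i)) * W J $$ (k, i))" for J
    unfolding t_def mat_trace_carrier[OF mult_carrier_mat[OF dagger_carrier[OF W] W]]
    by (intro sum.cong) (simp_all add: index_mult_mat_sum[OF dagger_carrier[OF W] W] index_dagger[OF W] del: index_mult_mat)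
  have fin: "finite (gca_indices m d)"
    by (simp add: gca_indices_def finite_PiE)
  have t0: "t J = 0" if J: "J \<in> gca_indices m d" "J \<noteq> K" for J
  proof -
    obtain l where l: "l \<in> {1..2 * P}" "skew_word m l (monom_word d K) \<noteq> skew_word m l (monom_word d J)"
      using skew_monom_word_separates[OF K J(1) assms(2)] J(2) by blast
    have sub: "set (monom_word d J) \<subseteq> {1..2 * P}" for J
      using set_monom_word[of d J] assms(2) by fastforce
    show ?thesis
      unfolding t_def W_def by (rule mat_trace_word_mat_orthogonal[OF assms(1) l(1) sub sub l(2)])
  qed
  have tK: "t K = of_nat ?N"
    using unitary_word_mat[of m P "monom_word d K"]
    by (simp add: t_def W_def unitary_mat_def mat_trace_def)
  have "(\<Sum>J\<in>gca_indices m d. u J * t J)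
      = (\<Sum>i<?N. \<Sum>k<?N. \<Sum>J\<in>gca_indices m d. cnj (W K $$ (k, i)) * (u J * W J $$ (k, i)))"
    unfolding t sum_distrib_left
    by (subst sum.swap, rule sum.cong[OF refl], subst sum.swap, rule sum.cong[OF refl]) (simp add: mult_ac)
  also have "\<dots> = 0"
    unfolding sum_distrib_left[symmetric] W_def using zero by (intro sum.neutral ballI) simp
  finally have "(\<Sum>J\<in>gca_indices m d. u J * t J) = 0" .
  moreover have "(\<Sum>J\<in>gca_indices m d. u J * t J) = (\<Sum>J\<in>{K}. u J * t J)"
    using K fin t0 by (intro sum.mono_neutral_right) auto
  ultimately show "u K = 0"
    using assms(1) tK by simp
qed

section \<open>The representation of the free algebra\<close>

lemma poly_mapping_sum_single: "p = (\<Sum>w\<in>Poly_Mapping.keys p. Poly_Mapping.single w (Poly_Mapping.lookup p w))"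
  by (rule poly_mapping_eqI)
    (auto simp: lookup_sum lookup_single when_def in_keys_iff)

text \<open>The case of a single term is restricted to words occurring in \<open>p\<close>, so that
  information about the letters of \<open>p\<close> survives the induction, while its coefficient is
  arbitrary.\<close>

lemma poly_mapping_span_induct:
  fixes p :: "'a \<Rightarrow>\<^sub>0 'b::comm_monoid_add"
  assumes "Q 0" "\<And>w c. w \<in> Poly_Mapping.keys p \<Longrightarrow> Q (Poly_Mapping.single w c)"
    and "\<And>a b. Q a \<Longrightarrow> Q b \<Longrightarrow> Q (a + b)"
  shows "Q p"
proof -
  have "Q (\<Sum>w\<in>S. Poly_Mapping.single w (Poly_Mapping.lookup p w))"
    if "finite S" "S \<subseteq> Poly_Mapping.keys p" for S
    using that by (induction S) (auto intro: assms)
  from this[OF finite_keys order_refl] show ?thesis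
    by (simp flip: poly_mapping_sum_single)
qed

text \<open>Every letter has a matrix, so this is defined on the whole type of polynomials and the
  ring identities hold there. The restriction to letters 1..d enters only with the relators and the
  block form.\<close>

definition rep_mat :: "nat \<Rightarrow> nat \<Rightarrow> nc_poly \<Rightarrow> complex mat" where
  "rep_mat m P p = mat (m ^ P) (m ^ P) (\<lambda>ij. \<Sum>w\<in>Poly_Mapping.keys p.
     Poly_Mapping.lookup p w * word_mat m P (letters w) $$ ij)"

lemma rep_mat_carrier [simp]: "rep_mat m P p \<in> carrier_mat (m ^ P) (m ^ P)"
  by (simp add: rep_mat_def)

lemma index_rep_mat:
  assumes "i < m ^ P" "j < m ^ P" "finite S" "Poly_Mapping.keys p \<subseteq> S"
  shows "rep_mat m P p $$ (i, j) = (\<Sum>w\<in>S. Poly_Mapping.lookup p w * word_mat m P (letters w) $$ (i, j))"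
proof -
  have "rep_mat m P p $$ (i, j)
      = (\<Sum>w\<in>Poly_Mapping.keys p. Poly_Mapping.lookup p w * word_mat m P (letters w) $$ (i, j))"
    using assms(1,2) by (simp add: rep_mat_def)
  also have "\<dots> = (\<Sum>w\<in>S. Poly_Mapping.lookup p w * word_mat m P (letters w) $$ (i, j))"
    using assms(3,4) by (intro sum.mono_neutral_left) (auto simp: in_keys_iff)
  finally show ?thesis .
qed

lemma rep_mat_add: "rep_mat m P (p + q) = rep_mat m P p + rep_mat m P q"
proof (rule eq_matI)
  fix i j assume "i < dim_row (rep_mat m P p + rep_mat m P q)" "j < dim_col (rep_mat m P p + rep_mat m P q)"
  then have ij: "i < m ^ P" "j < m ^ P" by (auto simp: rep_mat_def)
  let ?S = "Poly_Mapping.keys p \<union> Poly_Mapping.keys q"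
  note idx = index_rep_mat[OF ij, of ?S]
  show "rep_mat m P (p + q) $$ (i, j) = (rep_mat m P p + rep_mat m P q) $$ (i, j)"
    using ij keys_add[of p q] idx[of "p + q"] idx[of p] idx[of q]
    by (simp add: lookup_add algebra_simps sum.distrib carrier_matD[OF rep_mat_carrier])
qed (auto simp: rep_mat_def)

lemma rep_mat_single: "rep_mat m P (Poly_Mapping.single w c) = c \<cdot>\<^sub>m word_mat m P (letters w)"
proof (rule eq_matI)
  fix i j assume "i < dim_row (c \<cdot>\<^sub>m word_mat m P (letters w))" "j < dim_col (c \<cdot>\<^sub>m word_mat m P (letters w))"
  then have ij: "i < m ^ P" "j < m ^ P"
    using carrier_matD[OF word_mat_carrier[of m P "letters w"]] by auto
  show "rep_mat m P (Poly_Mapping.single w c) $$ (i, j) = (c \<cdot>\<^sub>m word_mat m P (letters w)) $$ (i, j)"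
    using ij carrier_matD[OF word_mat_carrier[of m P "letters w"]] by (subst index_rep_mat[OF ij, of "{w}"]) auto
qed (use carrier_matD[OF word_mat_carrier] in \<open>auto simp: rep_mat_def\<close>)

lemma rep_mat_zero: "rep_mat m P 0 = 0\<^sub>m (m ^ P) (m ^ P)"
  by (auto simp: rep_mat_def)

lemma rep_mat_one: "rep_mat m P 1 = 1\<^sub>m (m ^ P)"
proof -
  have "rep_mat m P 1 = 1 \<cdot>\<^sub>m 1\<^sub>m (m ^ P)"
    unfolding single_one[symmetric] rep_mat_single by (simp add: zero_nc_word_def)
  then show ?thesis by (auto intro!: eq_matI)
qed

lemma rep_mat_mult: "rep_mat m P (p * q) = rep_mat m P p * rep_mat m P q"
proof (rule poly_mapping_span_induct[of _ p])
  let ?N = "m ^ P"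
  note c = rep_mat_carrier[of m P]
  show "rep_mat m P (0 * q) = rep_mat m P 0 * rep_mat m P q"
    by (simp add: rep_mat_zero left_mult_zero_mat[OF rep_mat_carrier])
  show "rep_mat m P ((a + b) * q) = rep_mat m P (a + b) * rep_mat m P q"
    if "rep_mat m P (a * q) = rep_mat m P a * rep_mat m P q" "rep_mat m P (b * q) = rep_mat m P b * rep_mat m P q" for a b
    using that by (simp add: distrib_right rep_mat_add add_mult_distrib_mat[OF c c c])
  fix u a
  show "rep_mat m P (Poly_Mapping.single u a * q) = rep_mat m P (Poly_Mapping.single u a) * rep_mat m P q"
  proof (rule poly_mapping_span_induct[of _ q])
    show "rep_mat m P (Poly_Mapping.single u a * 0) = rep_mat m P (Poly_Mapping.single u a) * rep_mat m P 0"
      by (simp add: rep_mat_zero right_mult_zero_mat[OF rep_mat_carrier])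
    show "rep_mat m P (Poly_Mapping.single u a * (b + b')) = rep_mat m P (Poly_Mapping.single u a) * rep_mat m P (b + b')"
      if "rep_mat m P (Poly_Mapping.single u a * b) = rep_mat m P (Poly_Mapping.single u a) * rep_mat m P b"
        "rep_mat m P (Poly_Mapping.single u a * b') = rep_mat m P (Poly_Mapping.single u a) * rep_mat m P b'" for b b'
      using that by (simp add: distrib_left rep_mat_add mult_add_distrib_mat[OF c c c])
    fix v b
    let ?u = "word_mat m P (letters u)" and ?v = "word_mat m P (letters v)"
    have "(a \<cdot>\<^sub>m ?u) * (b \<cdot>\<^sub>m ?v) = a \<cdot>\<^sub>m (?u * (b \<cdot>\<^sub>m ?v))"
      by (rule mult_smult_assoc_mat[OF word_mat_carrier smult_carrier_mat[OF word_mat_carrier]])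
    also have "\<dots> = a \<cdot>\<^sub>m (b \<cdot>\<^sub>m (?u * ?v))"
      by (simp only: mult_smult_distrib[OF word_mat_carrier word_mat_carrier])
    finally show "rep_mat m P (Poly_Mapping.single u a * Poly_Mapping.single v b)
        = rep_mat m P (Poly_Mapping.single u a) * rep_mat m P (Poly_Mapping.single v b)"
      by (simp add: mult_single rep_mat_single plus_nc_word_def word_mat_append smult_smult_mat)
  qed
qed

lemma rep_mat_diff: "rep_mat m P (p - q) = 0\<^sub>m (m ^ P) (m ^ P) \<longleftrightarrow> rep_mat m P p = rep_mat m P q"
proof -
  have eq: "rep_mat m P p = rep_mat m P (p - q) + rep_mat m P q"
    by (simp flip: rep_mat_add)
  show ?thesis
  proof
    assume "rep_mat m P (p - q) = 0\<^sub>m (m ^ P) (m ^ P)"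
    then show "rep_mat m P p = rep_mat m P q"
      unfolding eq by (simp add: left_add_zero_mat[OF rep_mat_carrier])
  next
    assume pq: "rep_mat m P p = rep_mat m P q"
    show "rep_mat m P (p - q) = 0\<^sub>m (m ^ P) (m ^ P)"
    proof (rule eq_matI)
      fix i j assume "i < dim_row (0\<^sub>m (m ^ P) (m ^ P))" "j < dim_col (0\<^sub>m (m ^ P) (m ^ P))"
      then have "(rep_mat m P (p - q) + rep_mat m P q) $$ (i, j)
          = rep_mat m P (p - q) $$ (i, j) + rep_mat m P q $$ (i, j)" "i < m ^ P" "j < m ^ P"
        using carrier_matD[OF rep_mat_carrier] by auto
      then show "rep_mat m P (p - q) $$ (i, j) = 0\<^sub>m (m ^ P) (m ^ P) $$ (i, j)"
        using eq pq by (metis add_cancel_right_left index_zero_mat(1))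
    qed (use carrier_matD[OF rep_mat_carrier] in auto)
  qed
qed

lemma nc_var_power: "nc_var j ^ n = Poly_Mapping.single (Word (replicate n j)) 1"
  by (induction n) (simp_all add: nc_var_def mult_single plus_nc_word_def flip: single_one zero_nc_word_def)

lemma rep_mat_const_mult: "rep_mat m P (nc_const c * p) = c \<cdot>\<^sub>m rep_mat m P p"
proof -
  have "rep_mat m P (nc_const c) = c \<cdot>\<^sub>m 1\<^sub>m (m ^ P)"
    by (simp add: nc_const_def rep_mat_single zero_nc_word_def)
  then show ?thesis
    by (simp add: rep_mat_mult mult_smult_assoc_mat[OF one_carrier_mat rep_mat_carrier]
        left_mult_one_mat[OF rep_mat_carrier])
qed

lemma rep_mat_relators:
  assumes "m > 0" "d \<le> 2 * P" "r \<in> gca_relators m d"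
  shows "rep_mat m P r = 0\<^sub>m (m ^ P) (m ^ P)"
proof -
  have var: "rep_mat m P (nc_var j) = gen_mat m P j" for j
    unfolding nc_var_def rep_mat_single using right_mult_one_mat[OF gen_mat_carrier]
    by (auto intro!: eq_matI)
  consider j where "j \<in> {1..d}" "r = nc_var j ^ m - 1"
    | k l where "1 \<le> k" "k < l" "l \<le> d" "r = nc_var k * nc_var l - nc_const (gca_omega m) * nc_var l * nc_var k"
    using assms(3) unfolding gca_relators_def by blast
  then show ?thesis
  proof cases
    case 1
    have "rep_mat m P (nc_var j ^ m) = rep_mat m P 1"
      unfolding nc_var_power rep_mat_single using gen_mat_pow[OF assms(1)]
      by (auto simp: word_mat_replicate rep_mat_one intro!: eq_matI)
    then show ?thesis unfolding 1 rep_mat_diff .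
  next
    case 2
    have "rep_mat m P (nc_var k * nc_var l) = gca_omega m \<cdot>\<^sub>m rep_mat m P (nc_var l * nc_var k)"
      unfolding rep_mat_mult var using gen_mat_skew_commute[of m k l P] 2 assms by simp
    then have "rep_mat m P (nc_var k * nc_var l) = rep_mat m P (nc_const (gca_omega m) * (nc_var l * nc_var k))"
      by (simp only: rep_mat_const_mult)
    then show ?thesis unfolding 2 rep_mat_diff by (simp only: mult.assoc)
  qed
qed

lemma free_alg_simps [simp]:
  "add (free_alg d) = (+)" "zero (free_alg d) = 0" "monoid.mult (free_alg d) = (*)" "one (free_alg d) = 1"
  by (simp_all add: free_alg_def)

lemma free_alg_closed:
  shows free_alg_add: "p \<in> carrier (free_alg d) \<Longrightarrow> q \<in> carrier (free_alg d) \<Longrightarrow> p + q \<in> carrier (free_alg d)"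
    and free_alg_uminus: "p \<in> carrier (free_alg d) \<Longrightarrow> - p \<in> carrier (free_alg d)"
    and free_alg_single: "set w \<subseteq> {1..d} \<Longrightarrow> Poly_Mapping.single (Word w) c \<in> carrier (free_alg d)"
    and free_alg_const: "nc_const c \<in> carrier (free_alg d)"
    and free_alg_zero: "0 \<in> carrier (free_alg d)"
proof -
  interpret ring "free_alg d" by (rule ring_free_alg)
  show "p \<in> carrier (free_alg d) \<Longrightarrow> q \<in> carrier (free_alg d) \<Longrightarrow> p + q \<in> carrier (free_alg d)"
    using a_closed by simp
  show "- p \<in> carrier (free_alg d)" if "p \<in> carrier (free_alg d)"
    using that by (simp add: in_free_alg)
  show "set w \<subseteq> {1..d} \<Longrightarrow> Poly_Mapping.single (Word w) c \<in> carrier (free_alg d)"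
    by (simp add: in_free_alg)
  show "nc_const c \<in> carrier (free_alg d)"
    by (simp add: in_free_alg nc_const_def zero_nc_word_def)
  show "0 \<in> carrier (free_alg d)" by (simp add: in_free_alg)
qed

lemma free_alg_sum:
  "(\<And>x. x \<in> S \<Longrightarrow> f x \<in> carrier (free_alg d)) \<Longrightarrow> sum f S \<in> carrier (free_alg d)"
  by (induction S rule: infinite_finite_induct) (auto intro: free_alg_zero free_alg_add)

lemma free_alg_a_inv: "p \<in> carrier (free_alg d) \<Longrightarrow> \<ominus>\<^bsub>free_alg d\<^esub> p = - p"
proof -
  assume p: "p \<in> carrier (free_alg d)"
  interpret ring "free_alg d" by (rule ring_free_alg)
  show ?thesis using minus_equality[of "- p" p] p free_alg_uminus[OF p] by simp
qed

lemma rep_mat_ring_hom: "ring_hom_ring (free_alg d) (ring_mat TYPE(complex) (m ^ P) ()) (rep_mat m P)"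
proof (rule ring_hom_ringI2[OF ring_free_alg ring_mat])
  show "rep_mat m P \<in> Ring.ring_hom (free_alg d) (ring_mat TYPE(complex) (m ^ P) ())"
    by (rule ring_hom_memI) (simp_all add: ring_mat_def rep_mat_add rep_mat_mult rep_mat_one)
qed

lemma gca_ideal_subset_kernel:
  assumes "m > 0" "d \<le> 2 * P"
  shows "gca_ideal m d \<subseteq> a_kernel (free_alg d) (ring_mat TYPE(complex) (m ^ P) ()) (rep_mat m P)"
proof -
  interpret h: ring_hom_ring "free_alg d" "ring_mat TYPE(complex) (m ^ P) ()" "rep_mat m P"
    by (rule rep_mat_ring_hom)
  show ?thesis
    unfolding gca_ideal_def
  proof (rule h.R.genideal_minimal[OF h.kernel_is_ideal])
    show "gca_relators m d \<subseteq> a_kernel (free_alg d) (ring_mat TYPE(complex) (m ^ P) ()) (rep_mat m P)"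
    proof
      fix r assume r: "r \<in> gca_relators m d"
      then have "r \<in> carrier (free_alg d)" using gca_relators_subset by blast
      moreover have "rep_mat m P r = \<zero>\<^bsub>ring_mat TYPE(complex) (m ^ P) ()\<^esub>"
        using rep_mat_relators[OF assms r] by (simp add: ring_mat_def)
      ultimately show "r \<in> a_kernel (free_alg d) (ring_mat TYPE(complex) (m ^ P) ()) (rep_mat m P)"
        unfolding a_kernel_def' by blast
    qed
  qed
qed

section \<open>Monomials span the algebra\<close>

text \<open>Congruence modulo the ideal, kept on polynomials so that words can be rewritten with
  ordinary sums and products; cosets enter only with \<open>gca_class\<close>.\<close>

definition gca_eqv :: "nat \<Rightarrow> nat \<Rightarrow> nc_poly \<Rightarrow> nc_poly \<Rightarrow> bool" where
  "gca_eqv m d p q \<longleftrightarrow> p - q \<in> gca_ideal m d"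

lemma gca_ideal_closed:
  shows gca_ideal_add: "p \<in> gca_ideal m d \<Longrightarrow> q \<in> gca_ideal m d \<Longrightarrow> p + q \<in> gca_ideal m d"
    and gca_ideal_zero: "0 \<in> gca_ideal m d"
    and gca_ideal_lmult: "p \<in> gca_ideal m d \<Longrightarrow> a \<in> carrier (free_alg d) \<Longrightarrow> a * p \<in> gca_ideal m d"
    and gca_ideal_rmult: "p \<in> gca_ideal m d \<Longrightarrow> a \<in> carrier (free_alg d) \<Longrightarrow> p * a \<in> gca_ideal m d"
    and gca_ideal_uminus: "p \<in> gca_ideal m d \<Longrightarrow> - p \<in> gca_ideal m d"
proof -
  interpret I: ideal "gca_ideal m d" "free_alg d" by (rule ideal_gca_ideal)
  note add = ideal.axioms(1)[OF ideal_gca_ideal]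
  show "p \<in> gca_ideal m d \<Longrightarrow> q \<in> gca_ideal m d \<Longrightarrow> p + q \<in> gca_ideal m d"
    using additive_subgroup.a_closed[OF add] by fastforce
  show "0 \<in> gca_ideal m d" using additive_subgroup.zero_closed[OF add] by simp
  show lmult: "a * p \<in> gca_ideal m d" if "p \<in> gca_ideal m d" "a \<in> carrier (free_alg d)" for a p
    using I.I_l_closed[OF that] by simp
  show "p \<in> gca_ideal m d \<Longrightarrow> a \<in> carrier (free_alg d) \<Longrightarrow> p * a \<in> gca_ideal m d"
    using I.I_r_closed[of p a] by simp
  \<comment> \<open>Negation becomes multiplication by a constant polynomial, to which absorption by
    the ideal applies.\<close>
  have "nc_const (- 1) = - 1"
    by (simp add: nc_const_def single_uminus)
  then show "p \<in> gca_ideal m d \<Longrightarrow> - p \<in> gca_ideal m d"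
    using lmult[OF _ free_alg_const, of p "- 1"] by simp
qed

lemma gca_eqv_refl: "gca_eqv m d p p"
  by (simp add: gca_eqv_def gca_ideal_zero)

lemma gca_eqv_sym: "gca_eqv m d p q \<Longrightarrow> gca_eqv m d q p"
  using gca_ideal_uminus[of "p - q"] by (simp add: gca_eqv_def)

lemma gca_eqv_trans: "gca_eqv m d p q \<Longrightarrow> gca_eqv m d q r \<Longrightarrow> gca_eqv m d p r"
  using gca_ideal_add[of "p - q" m d "q - r"] by (simp add: gca_eqv_def)

lemma gca_eqv_add: "gca_eqv m d p q \<Longrightarrow> gca_eqv m d p' q' \<Longrightarrow> gca_eqv m d (p + p') (q + q')"
  using gca_ideal_add[of "p - q" m d "p' - q'"] by (simp add: gca_eqv_def algebra_simps)

lemma gca_eqv_lmult: "gca_eqv m d p q \<Longrightarrow> a \<in> carrier (free_alg d) \<Longrightarrow> gca_eqv m d (a * p) (a * q)"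
  using gca_ideal_lmult[of "p - q" m d a] by (simp add: gca_eqv_def right_diff_distrib)

lemma gca_eqv_rmult: "gca_eqv m d p q \<Longrightarrow> a \<in> carrier (free_alg d) \<Longrightarrow> gca_eqv m d (p * a) (q * a)"
  using gca_ideal_rmult[of "p - q" m d a] by (simp add: gca_eqv_def left_diff_distrib)

lemma gca_eqv_relators:
  assumes "p - q \<in> gca_relators m d"
  shows "gca_eqv m d p q"
proof -
  interpret ring "free_alg d" by (rule ring_free_alg)
  show ?thesis
    using genideal_self[OF gca_relators_subset] assms unfolding gca_eqv_def gca_ideal_def by blast
qed

text \<open>The scalar is left unspecified: for spanning only its existence counts, so the powers of
  \<omega> produced by reordering need not be tracked.\<close>

definition word_eqv :: "nat \<Rightarrow> nat \<Rightarrow> nat list \<Rightarrow> nat list \<Rightarrow> bool" where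
  "word_eqv m d u v \<longleftrightarrow> (\<exists>c. gca_eqv m d (Poly_Mapping.single (Word u) 1) (Poly_Mapping.single (Word v) c))"

lemma nc_const_mult_single: "nc_const c * Poly_Mapping.single w c' = Poly_Mapping.single w (c * c')"
  by (simp add: nc_const_def mult_single)

lemma word_eqv_scale:
  assumes "word_eqv m d u v"
  obtains c' where "gca_eqv m d (Poly_Mapping.single (Word u) c) (Poly_Mapping.single (Word v) c')"
proof -
  obtain c0 where "gca_eqv m d (Poly_Mapping.single (Word u) 1) (Poly_Mapping.single (Word v) c0)"
    using assms by (auto simp: word_eqv_def)
  from gca_eqv_lmult[OF this free_alg_const[of c]] show ?thesis
    by (intro that[of "c * c0"]) (simp add: nc_const_mult_single)
qed

lemma word_eqv_refl: "word_eqv m d u u"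
  unfolding word_eqv_def using gca_eqv_refl by blast

lemma word_eqv_trans:
  assumes "word_eqv m d u v" "word_eqv m d v w"
  shows "word_eqv m d u w"
proof -
  obtain c where c: "gca_eqv m d (Poly_Mapping.single (Word u) 1) (Poly_Mapping.single (Word v) c)"
    using assms(1) by (auto simp: word_eqv_def)
  obtain c' where "gca_eqv m d (Poly_Mapping.single (Word v) c) (Poly_Mapping.single (Word w) c')"
    by (rule word_eqv_scale[OF assms(2)])
  from gca_eqv_trans[OF c this] show ?thesis by (auto simp: word_eqv_def)
qed

lemma word_eqv_append:
  assumes "word_eqv m d u v" "set a \<subseteq> {1..d}" "set b \<subseteq> {1..d}"
  shows "word_eqv m d (a @ u @ b) (a @ v @ b)"
proof -
  obtain c where c: "gca_eqv m d (Poly_Mapping.single (Word u) 1) (Poly_Mapping.single (Word v) c)"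
    using assms(1) by (auto simp: word_eqv_def)
  let ?a = "Poly_Mapping.single (Word a) 1 :: nc_poly" and ?b = "Poly_Mapping.single (Word b) 1 :: nc_poly"
  have "gca_eqv m d (?a * (Poly_Mapping.single (Word u) 1 * ?b)) (?a * (Poly_Mapping.single (Word v) c * ?b))"
    by (intro gca_eqv_lmult gca_eqv_rmult c free_alg_single assms)
  then show ?thesis
    by (auto simp: word_eqv_def mult_single plus_nc_word_def)
qed

lemma word_eqv_swap:
  assumes "x \<in> {1..d}" "y \<in> {1..d}"
  shows "word_eqv m d [x, y] [y, x]"
proof -
  have var: "nc_var x * nc_var y = Poly_Mapping.single (Word [x, y]) 1" for x y
    by (simp add: nc_var_def mult_single plus_nc_word_def)
  have rel: "gca_eqv m d (Poly_Mapping.single (Word [k, l]) 1) (Poly_Mapping.single (Word [l, k]) (gca_omega m))"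
    if "1 \<le> k" "k < l" "l \<le> d" for k l
  proof -
    have "gca_eqv m d (nc_var k * nc_var l) (nc_const (gca_omega m) * nc_var l * nc_var k)"
      using that by (intro gca_eqv_relators) (auto simp: gca_relators_def)
    then show ?thesis
      by (simp add: mult.assoc var nc_const_mult_single)
  qed
  consider "x < y" | "x = y" | "y < x" by linarith
  then show ?thesis
  proof cases
    case 1
    then show ?thesis using rel[of x y] assms by (auto simp: word_eqv_def)
  next
    case 2
    then show ?thesis by (simp add: word_eqv_refl)
  next
    case 3
    then have "gca_eqv m d (Poly_Mapping.single (Word [x, y]) (gca_omega m)) (Poly_Mapping.single (Word [y, x]) 1)"
      by (intro gca_eqv_sym[OF rel]) (use assms in auto)
    from gca_eqv_lmult[OF this free_alg_const[of "inverse (gca_omega m)"]] show ?thesis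
      by (auto simp: word_eqv_def nc_const_mult_single)
  qed
qed

lemma word_eqv_replicate:
  assumes "k \<in> {1..d}"
  shows "word_eqv m d (replicate n k) (replicate (n mod m) k)"
proof (induction n rule: less_induct)
  case (less n)
  show ?case
  \<comment> \<open>For m = 0 the remainder \<open>n mod m\<close> is n itself, so the claim is
    reflexivity there too.\<close>
  proof (cases "n < m \<or> m = 0")
    case True
    then show ?thesis by (auto simp: word_eqv_refl)
  next
    case False
    have "gca_eqv m d (nc_var k ^ m) 1"
      using assms by (intro gca_eqv_relators) (auto simp: gca_relators_def)
    then have "word_eqv m d (replicate m k) []"
      unfolding nc_var_power word_eqv_def zero_nc_word_def[symmetric] single_one[symmetric] by blast
    then have 1: "word_eqv m d ([] @ replicate m k @ replicate (n - m) k) ([] @ [] @ replicate (n - m) k)"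
      using assms by (intro word_eqv_append) auto
    moreover have "replicate m k @ replicate (n - m) k = replicate n k"
      using False by (simp flip: replicate_add)
    moreover have 2: "word_eqv m d (replicate (n - m) k) (replicate ((n - m) mod m) k)"
      using False by (intro less) auto
    moreover have "(n - m) mod m = n mod m"
      using False by (simp add: le_mod_geq)
    ultimately show ?thesis
      using word_eqv_trans[OF 1[simplified] 2] by simp
  qed
qed

lemma word_eqv_move:
  assumes "x \<in> {1..d}" "set v \<subseteq> {1..d}"
  shows "word_eqv m d (x # v) (v @ [x])"
  using assms(2)
proof (induction v)
  case (Cons y v)
  have 1: "word_eqv m d ([] @ [x, y] @ v) ([] @ [y, x] @ v)"
    using Cons.prems assms(1) by (intro word_eqv_append word_eqv_swap) auto
  have 2: "word_eqv m d ([y] @ (x # v) @ []) ([y] @ (v @ [x]) @ [])"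
    using Cons assms(1) by (intro word_eqv_append) auto
  show ?case using word_eqv_trans[OF 1[simplified] 2[simplified]] by simp
qed (simp add: word_eqv_refl)

text \<open>Induction on u: the tail is first rearranged into v with one occurrence of the head
  letter removed, and the head letter is then carried to that occurrence, each exchange costing only
  a scalar.\<close>

lemma word_eqv_mset:
  assumes "mset u = mset v" "set u \<subseteq> {1..d}"
  shows "word_eqv m d u v"
  using assms
proof (induction u arbitrary: v)
  case Nil
  then show ?case by (simp add: word_eqv_refl)
next
  case (Cons x u)
  have "x \<in> set v" using Cons.prems(1) by (metis list.set_intros(1) set_mset_mset)
  then obtain v1 v2 where v: "v = v1 @ x # v2" by (meson split_list)
  have sv: "set v \<subseteq> {1..d}" using Cons.prems by (metis set_mset_mset)
  have "word_eqv m d ([x] @ u @ []) ([x] @ (v1 @ v2) @ [])"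
    using Cons v by (intro word_eqv_append) auto
  moreover have "word_eqv m d ([] @ (x # v1) @ v2) ([] @ (v1 @ [x]) @ v2)"
    using sv v by (intro word_eqv_append word_eqv_move) auto
  ultimately show ?case using word_eqv_trans v by simp
qed

lemma count_monom_word: "count (mset (monom_word d c)) x = (if x \<in> {1..d} then c x else 0)"
proof -
  have "count (mset (concat (map (\<lambda>k. replicate (c k) k) ks))) x = (if x \<in> set ks then c x else 0)"
    if "distinct ks" for ks
    using that by (induction ks) auto
  then show ?thesis by (simp add: monom_word_def atLeastLessThanSuc_atLeastAtMost del: upt_Suc)
qed

lemma word_eqv_monom_word:
  assumes "m > 0" "set u \<subseteq> {1..d}"
  obtains J where "J \<in> gca_indices m d" "word_eqv m d u (monom_word d J)"
proof -
  define c where "c = count (mset u)"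
  \<comment> \<open>The letter counts \<open>c\<close> are exponents before reduction modulo m.
    Restriction is needed because \<open>gca_indices\<close> consists of extensional
    functions.\<close>
  define J where "J = restrict (\<lambda>k. c k mod m) {1..d}"
  have "mset u = mset (monom_word d c)"
  proof (rule multiset_eqI)
    fix x show "count (mset u) x = count (mset (monom_word d c)) x"
      using assms(2) unfolding count_monom_word c_def
      by (auto simp: count_eq_zero_iff)
  qed
  then have "word_eqv m d u (monom_word d c)"
    using assms(2) by (rule word_eqv_mset)
  moreover have reduce: "word_eqv m d (concat (map (\<lambda>k. replicate (c k) k) ks)) (concat (map (\<lambda>k. replicate (J k) k) ks))"
    if "set ks \<subseteq> {1..d}" for ks
    using that
  proof (induction ks)
    case (Cons k ks)
    have 1: "word_eqv m d ([] @ replicate (c k) k @ concat (map (\<lambda>k. replicate (c k) k) ks))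
        ([] @ replicate (J k) k @ concat (map (\<lambda>k. replicate (c k) k) ks))"
      using Cons.prems word_eqv_replicate[of k d m "c k"] by (intro word_eqv_append) (auto simp: J_def)
    have 2: "word_eqv m d (replicate (J k) k @ concat (map (\<lambda>k. replicate (c k) k) ks) @ [])
        (replicate (J k) k @ concat (map (\<lambda>k. replicate (J k) k) ks) @ [])"
      using Cons by (intro word_eqv_append) auto
    show ?case using word_eqv_trans[OF 1[simplified] 2[simplified]] by simp
  qed (simp add: word_eqv_refl)
  have "word_eqv m d (monom_word d c) (monom_word d J)"
    unfolding monom_word_def by (rule reduce) auto
  ultimately have "word_eqv m d u (monom_word d J)" by (rule word_eqv_trans)
  moreover have "J \<in> gca_indices m d"
    using assms(1) by (auto simp: J_def gca_indices_def)
  ultimately show ?thesis using that by blast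
qed

text \<open>The lift to the free algebra of the expansion that appears in
  \<open>gca_coeffs\<close>.\<close>

definition gca_comb :: "nat \<Rightarrow> nat \<Rightarrow> (nat \<Rightarrow> nat) set \<Rightarrow> ((nat \<Rightarrow> nat) \<Rightarrow> complex) \<Rightarrow> nc_poly" where
  "gca_comb m d S u = (\<Sum>J\<in>S. Poly_Mapping.single (Word (monom_word d J)) (u J))"

lemma finite_gca_indices: "finite (gca_indices m d)"
  by (simp add: gca_indices_def finite_PiE)

lemma gca_comb_closed: "gca_comb m d S u \<in> carrier (free_alg d)"
  unfolding gca_comb_def by (intro free_alg_sum free_alg_single set_monom_word)

lemma gca_eqv_gca_comb:
  assumes "m > 0" "p \<in> carrier (free_alg d)"
  obtains u where "gca_eqv m d p (gca_comb m d (gca_indices m d) u)"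
proof -
  have "\<exists>u. gca_eqv m d p (gca_comb m d (gca_indices m d) u)"
  proof (rule poly_mapping_span_induct[of _ p])
    have "gca_comb m d (gca_indices m d) (\<lambda>_. 0) = 0"
      by (simp add: gca_comb_def)
    then show "\<exists>u. gca_eqv m d 0 (gca_comb m d (gca_indices m d) u)"
      by (metis gca_eqv_refl)
  next
    fix w c assume "w \<in> Poly_Mapping.keys p"
    then have "set (letters w) \<subseteq> {1..d}" using assms(2) by (simp add: in_free_alg)
    then obtain J where J: "J \<in> gca_indices m d" "word_eqv m d (letters w) (monom_word d J)"
      by (rule word_eqv_monom_word[OF assms(1)])
    obtain c' where c': "gca_eqv m d (Poly_Mapping.single (Word (letters w)) c) (Poly_Mapping.single (Word (monom_word d J)) c')"
      by (rule word_eqv_scale[OF J(2)])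
    have "gca_comb m d (gca_indices m d) (\<lambda>K. if K = J then c' else 0)
        = (\<Sum>K\<in>{J}. Poly_Mapping.single (Word (monom_word d K)) (if K = J then c' else 0))"
      unfolding gca_comb_def using J(1) finite_gca_indices by (intro sum.mono_neutral_right) auto
    with c' show "\<exists>u. gca_eqv m d (Poly_Mapping.single w c) (gca_comb m d (gca_indices m d) u)"
      by (intro exI[of _ "\<lambda>K. if K = J then c' else 0"]) simp
  next
    fix a b assume "\<exists>u. gca_eqv m d a (gca_comb m d (gca_indices m d) u)"
      "\<exists>u. gca_eqv m d b (gca_comb m d (gca_indices m d) u)"
    then obtain u v where "gca_eqv m d a (gca_comb m d (gca_indices m d) u)"
      "gca_eqv m d b (gca_comb m d (gca_indices m d) v)" by blast
    from gca_eqv_add[OF this]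
    have "gca_eqv m d (a + b) (gca_comb m d (gca_indices m d) (\<lambda>J. u J + v J))"
      by (simp add: gca_comb_def single_add sum.distrib)
    then show "\<exists>u. gca_eqv m d (a + b) (gca_comb m d (gca_indices m d) u)" by blast
  qed
  then show ?thesis using that by blast
qed

lemma index_rep_mat_gca_comb:
  assumes "i < m ^ P" "j < m ^ P"
  shows "rep_mat m P (gca_comb m d S u) $$ (i, j) = (\<Sum>J\<in>S. u J * word_mat m P (monom_word d J) $$ (i, j))"
proof (induction S rule: infinite_finite_induct)
  case (insert J S)
  then show ?case
    using assms carrier_matD[OF rep_mat_carrier] carrier_matD[OF word_mat_carrier]
    by (simp add: gca_comb_def rep_mat_add rep_mat_single)
qed (use assms in \<open>simp_all add: gca_comb_def rep_mat_zero\<close>)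

text \<open>Modulo the ideal \<open>p\<close> is a combination of monomials with the same matrix,
  here zero, and independence kills all coefficients. This shows at once that the relations are
  complete for the matrices and that the monomial classes are independent.\<close>

lemma rep_mat_eq_zero_imp_ideal:
  assumes "m > 0" "d \<le> 2 * P" "p \<in> carrier (free_alg d)" "rep_mat m P p = 0\<^sub>m (m ^ P) (m ^ P)"
  shows "p \<in> gca_ideal m d"
proof -
  obtain u where u: "gca_eqv m d p (gca_comb m d (gca_indices m d) u)"
    by (rule gca_eqv_gca_comb[OF assms(1,3)])
  then have "rep_mat m P (p - gca_comb m d (gca_indices m d) u) = 0\<^sub>m (m ^ P) (m ^ P)"
    using gca_ideal_subset_kernel[OF assms(1,2)] by (auto simp: gca_eqv_def a_kernel_def' ring_mat_def)
  then have eq: "rep_mat m P (gca_comb m d (gca_indices m d) u) = 0\<^sub>m (m ^ P) (m ^ P)"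
    unfolding rep_mat_diff using assms(4) by simp
  have "u J = 0" if "J \<in> gca_indices m d" for J
    by (rule monom_mats_independent[OF assms(1,2) _ that, of u])
      (simp add: eq flip: index_rep_mat_gca_comb)
  then have "gca_comb m d (gca_indices m d) u = 0"
    by (simp add: gca_comb_def)
  with u show ?thesis by (simp add: gca_eqv_def)
qed

lemma gca_ideal_eq_kernel:
  assumes "m > 0" "d \<le> 2 * P"
  shows "a_kernel (free_alg d) (ring_mat TYPE(complex) (m ^ P) ()) (rep_mat m P) = gca_ideal m d"
proof
  show "gca_ideal m d \<subseteq> a_kernel (free_alg d) (ring_mat TYPE(complex) (m ^ P) ()) (rep_mat m P)"
    by (rule gca_ideal_subset_kernel[OF assms])
  show "a_kernel (free_alg d) (ring_mat TYPE(complex) (m ^ P) ()) (rep_mat m P) \<subseteq> gca_ideal m d"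
    unfolding a_kernel_def' using rep_mat_eq_zero_imp_ideal[OF assms] by (auto simp: ring_mat_def)
qed

section \<open>Surjectivity\<close>

text \<open>Both index sets are enumerated by {..<n}, which turns the family into a square matrix.
  Independence says that it has trivial kernel, hence nonzero determinant, and its inverse yields
  the coefficients. Keeping \<open>D\<close> an arbitrary finite set allows it to be the set of
  positions inside the blocks.\<close>

lemma independent_family_spans:
  fixes M :: "'i \<Rightarrow> 'd \<Rightarrow> 'a::field"
  assumes fin: "finite I" "finite D" and card: "card I = card D"
    and indep: "\<And>u J. (\<And>p. p \<in> D \<Longrightarrow> (\<Sum>J\<in>I. u J * M J p) = 0) \<Longrightarrow> J \<in> I \<Longrightarrow> u J = 0"
  shows "\<exists>u. \<forall>p\<in>D. (\<Sum>J\<in>I. u J * M J p) = x p"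
proof -
  define n where "n = card I"
  obtain f where f: "bij_betw f {..<n} I"
    using ex_bij_betw_nat_finite[OF fin(1)] by (auto simp: n_def lessThan_atLeast0)
  obtain g where g: "bij_betw g {..<n} D"
    using ex_bij_betw_nat_finite[OF fin(2)] by (auto simp: n_def card lessThan_atLeast0)
  let ?f' = "inv_into {..<n} f"
  define A where "A = mat n n (\<lambda>(a, b). M (f b) (g a))"
  have A: "A \<in> carrier_mat n n" by (simp add: A_def)
  have sum: "(\<Sum>J\<in>I. v $ ?f' J * M J (g a)) = (A *\<^sub>v v) $ a" if "v \<in> carrier_vec n" "a < n" for v a
  proof -
    have "(\<Sum>J\<in>I. v $ ?f' J * M J (g a)) = (\<Sum>b<n. v $ ?f' (f b) * M (f b) (g a))"
      by (rule sum.reindex_bij_betw[OF f, symmetric])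
    also have "\<dots> = (\<Sum>b<n. v $ b * M (f b) (g a))"
      using bij_betw_inv_into_left[OF f] by (intro sum.cong) auto
    also have "\<dots> = (A *\<^sub>v v) $ a"
      using that by (auto simp: A_def scalar_prod_def lessThan_atLeast0 mult.commute intro!: sum.cong)
    finally show ?thesis .
  qed
  have "v = 0\<^sub>v n" if v: "v \<in> carrier_vec n" "A *\<^sub>v v = 0\<^sub>v n" for v
  proof (rule eq_vecI)
    fix b assume "b < dim_vec (0\<^sub>v n)"
    then have b: "b < n" by simp
    have "v $ ?f' (f b) = 0"
    proof (rule indep[of "\<lambda>J. v $ ?f' J"])
      fix p assume "p \<in> D"
      then obtain a where "a < n" "p = g a" using g by (auto simp: bij_betw_def)
      then show "(\<Sum>J\<in>I. v $ ?f' J * M J p) = 0" using sum[OF v(1), of a] v(2) by simp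
    qed (use f b in \<open>auto simp: bij_betw_def\<close>)
    then show "v $ b = 0\<^sub>v n $ b"
      using bij_betw_inv_into_left[OF f, of b] b by simp
  qed (use v in auto)
  then have "det A \<noteq> 0"
    using det_0_iff_vec_prod_zero[OF A] by blast
  then have "A \<in> Units (ring_mat TYPE('a) n ())"
    by (intro det_non_zero_imp_unit[OF A])
  then obtain B where B: "B \<in> carrier_mat n n" "A * B = 1\<^sub>m n"
    unfolding Units_def ring_mat_def by auto
  define y where "y = vec n (\<lambda>a. x (g a))"
  have y: "y \<in> carrier_vec n" by (simp add: y_def)
  have "A *\<^sub>v (B *\<^sub>v y) = y"
    using assoc_mult_mat_vec[OF A B(1) y] B(2) y by simp
  then have "(\<Sum>J\<in>I. (B *\<^sub>v y) $ ?f' J * M J (g a)) = x (g a)" if "a < n" for a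
    using sum[of "B *\<^sub>v y" a] B(1) y that by (simp add: y_def)
  moreover have "\<exists>a<n. p = g a" if "p \<in> D" for p
    using g that by (auto simp: bij_betw_def)
  ultimately show ?thesis by (intro exI[of _ "\<lambda>J. (B *\<^sub>v y) $ ?f' J"]) blast
qed

section \<open>Block-diagonal matrices by entries, and the dimension count\<close>

lemma index_diag_block_mat:
  assumes "set As \<subseteq> carrier_mat n n"
  shows "diag_block_mat As \<in> carrier_mat (length As * n) (length As * n) \<and>
    (\<forall>i<length As * n. \<forall>j<length As * n. diag_block_mat As $$ (i, j) =
      (if i div n = j div n then As ! (i div n) $$ (i mod n, j mod n) else (0 :: complex)))"
  using assms
proof (induction As)
  case (Cons A As)
  let ?D = "diag_block_mat As" and ?N = "length As * n"
  have A: "A \<in> carrier_mat n n" and D: "?D \<in> carrier_mat ?N ?N"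
    and idx: "\<And>i j. i < ?N \<Longrightarrow> j < ?N \<Longrightarrow> ?D $$ (i, j) =
      (if i div n = j div n then As ! (i div n) $$ (i mod n, j mod n) else 0)"
    using Cons by auto
  have eq: "diag_block_mat (A # As) = four_block_mat A (0\<^sub>m n ?N) (0\<^sub>m ?N n) ?D"
    using A D by (simp add: Let_def)
  have shift: "i div n = Suc ((i - n) div n)" "i mod n = (i - n) mod n" if "\<not> i < n" "i < n + ?N" for i
  proof -
    have "n > 0" using that by (cases "n = 0") auto
    then show "i div n = Suc ((i - n) div n)" "i mod n = (i - n) mod n"
      using that by (simp_all add: le_div_geq le_mod_geq)
  qed
  have "diag_block_mat (A # As) $$ (i, j) =
      (if i div n = j div n then (A # As) ! (i div n) $$ (i mod n, j mod n) else 0)"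
    if ij: "i < n + ?N" "j < n + ?N" for i j
  proof -
    have "four_block_mat A (0\<^sub>m n ?N) (0\<^sub>m ?N n) ?D $$ (i, j) =
      (if i < n then if j < n then A $$ (i, j) else 0
       else if j < n then 0 else ?D $$ (i - n, j - n))"
      using ij A D by auto
    then show ?thesis
      unfolding eq using ij idx[of "i - n" "j - n"] shift[of i] shift[of j] by auto
  qed
  moreover have "diag_block_mat (A # As) \<in> carrier_mat (n + ?N) (n + ?N)"
    unfolding eq by (rule four_block_carrier_mat[OF A D])
  ultimately show ?case by simp
qed simp

lemma block_diag_mats_eq:
  assumes "n > 0"
  shows "block_diag_mats b n = block_mats b n"
proof (intro subset_antisym subsetI)
  fix X assume "X \<in> block_diag_mats b n"
  then obtain As where "X = diag_block_mat As" "length As = b" "set As \<subseteq> carrier_mat n n"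
    by (auto simp: block_diag_mats_def)
  then show "X \<in> block_mats b n"
    using index_diag_block_mat[of As n] by (intro block_matsI) auto
next
  fix X assume X: "X \<in> block_mats b n"
  define As where "As = map (\<lambda>c. mat n n (\<lambda>(a, a'). X $$ (c * n + a, c * n + a'))) [0..<b]"
  have As: "set As \<subseteq> carrier_mat n n" "length As = b"
    by (auto simp: As_def)
  have "X = diag_block_mat As"
  proof (rule eq_matI)
    fix i j assume "i < dim_row (diag_block_mat As)" "j < dim_col (diag_block_mat As)"
    then have ij: "i < b * n" "j < b * n"
      using index_diag_block_mat[OF As(1)] As(2) by auto
    have "As ! (i div n) $$ (i mod n, j mod n) = X $$ (i, j)" if "i div n = j div n"
    proof -
      have "As ! (i div n) $$ (i mod n, j mod n) = X $$ (i div n * n + i mod n, i div n * n + j mod n)"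
        using assms ij by (simp add: As_def div_mod_less)
      also have "i div n * n + j mod n = j" unfolding that by simp
      finally show ?thesis by simp
    qed
    then show "X $$ (i, j) = diag_block_mat As $$ (i, j)"
      using index_diag_block_mat[OF As(1)] As(2) ij block_matsD(2)[OF X ij] by simp
  qed (use index_diag_block_mat[OF As(1)] As(2) block_matsD(1)[OF X] in auto)
  with As show "X \<in> block_diag_mats b n"
    unfolding block_diag_mats_def by blast
qed

text \<open>The number of pairs of generators. Rounding up leaves one spare generator for odd
  \<open>d\<close>; it takes part in separating the monomials but in no word over 1..d.\<close>

definition gca_rank :: "nat \<Rightarrow> nat" where
  "gca_rank d = (d + 1) div 2"

definition gca_blocks :: "nat \<Rightarrow> nat \<Rightarrow> nat" where
  "gca_blocks m d = (if even d then 1 else m)"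

lemma gca_blocks_mult: "gca_blocks m d * m ^ (d div 2) = m ^ gca_rank d"
  by (auto simp: gca_blocks_def gca_rank_def elim!: oddE)

lemma gca_rank_ge: "d \<le> 2 * gca_rank d"
  by (auto simp: gca_rank_def)

lemma gca_mat_ring_eq:
  assumes "m > 0"
  shows "gca_mat_ring m d = ring_mat TYPE(complex) (m ^ gca_rank d) ()
    \<lparr>carrier := block_mats (gca_blocks m d) (m ^ (d div 2))\<rparr>"
proof (cases "even d")
  case True
  then have "gca_mat_size m d = m ^ gca_rank d" "gca_rank d = d div 2"
    by (auto simp: gca_mat_size_def gca_rank_def)
  with True show ?thesis
    by (simp add: gca_mat_ring_def gca_blocks_def block_mats_single[unfolded One_nat_def] ring_mat_def Let_def)
next
  case False
  then have "gca_mat_size m d = m ^ gca_rank d" "(d - 1) div 2 = d div 2"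
    by (auto simp: gca_mat_size_def gca_rank_def elim!: oddE)
  with False show ?thesis
    using assms by (simp add: gca_mat_ring_def gca_blocks_def block_diag_mats_eq Let_def)
qed

lemma word_mat_in_block_mats:
  assumes "set w \<subseteq> {1..d}"
  shows "word_mat m (gca_rank d) w \<in> block_mats (gca_blocks m d) (m ^ (d div 2))"
  using assms
proof (induction w)
  case Nil
  show ?case
    using one_in_block_mats[of "gca_blocks m d" "m ^ (d div 2)"] by (simp add: gca_blocks_mult)
next
  case (Cons x w)
  have "gen_mat m (gca_rank d) x \<in> block_mats (gca_blocks m d) (m ^ (d div 2))"
  proof (cases "even d")
    case True
    then have "gca_rank d = d div 2" by (auto simp: gca_rank_def)
    with True show ?thesis
      by (simp add: gca_blocks_def block_mats_single[unfolded One_nat_def])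
  next
    case False
    then have "gca_rank d = Suc (d div 2)" "x \<le> 2 * (d div 2) + 1"
      using Cons.prems by (auto simp: gca_rank_def elim!: oddE)
    with False show ?thesis
      using gen_mat_in_block_mats[of x "d div 2" m] by (simp add: gca_blocks_def del: gen_mat.simps)
  qed
  then show ?case
    using Cons by (simp add: mult_in_block_mats)
qed

lemma rep_mat_in_block_mats:
  assumes "p \<in> carrier (free_alg d)"
  shows "rep_mat m (gca_rank d) p \<in> block_mats (gca_blocks m d) (m ^ (d div 2))"
proof (rule poly_mapping_span_induct[of _ p])
  show "rep_mat m (gca_rank d) 0 \<in> block_mats (gca_blocks m d) (m ^ (d div 2))"
    using zero_in_block_mats[of "gca_blocks m d" "m ^ (d div 2)"] by (simp add: gca_blocks_mult rep_mat_zero)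
next
  fix w c assume "w \<in> Poly_Mapping.keys p"
  then have "set (letters w) \<subseteq> {1..d}" using assms by (simp add: in_free_alg)
  then show "rep_mat m (gca_rank d) (Poly_Mapping.single w c) \<in> block_mats (gca_blocks m d) (m ^ (d div 2))"
    unfolding rep_mat_single by (intro smult_in_block_mats word_mat_in_block_mats)
qed (simp add: rep_mat_add add_in_block_mats)

lemma card_same_block:
  assumes "n > 0"
  shows "card {p. fst p < b * n \<and> snd p < b * n \<and> fst p div n = snd p div n} = b * (n * n)"
    and "finite {p. fst p < b * n \<and> snd p < b * n \<and> fst p div n = snd p div n}"
proof -
  let ?D = "{p. fst p < b * n \<and> snd p < b * n \<and> fst p div n = snd p div n}"
  have "bij_betw (\<lambda>(c, a, a'). (c * n + a, c * n + a')) ({..<b} \<times> {..<n} \<times> {..<n}) ?D"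
  proof (rule bij_betw_byWitness[of _ "\<lambda>p. (fst p div n, fst p mod n, snd p mod n)"])
    have less: "c * n + a < b * n" if "c < b" "a < n" for c a
    proof -
      have "c * n + a < Suc c * n" using that by simp
      also have "\<dots> \<le> b * n" using that by (intro mult_right_mono) auto
      finally show ?thesis .
    qed
    show "(\<lambda>(c, a, a'). (c * n + a, c * n + a')) ` ({..<b} \<times> {..<n} \<times> {..<n}) \<subseteq> ?D"
      using less by auto
    show "\<forall>p\<in>?D. (\<lambda>(c, a, a'). (c * n + a, c * n + a')) (fst p div n, fst p mod n, snd p mod n) = p"
    proof
      fix p assume p: "p \<in> ?D"
      then have "fst p div n * n + snd p mod n = snd p div n * n + snd p mod n" by simp
      then show "(\<lambda>(c, a, a'). (c * n + a, c * n + a')) (fst p div n, fst p mod n, snd p mod n) = p"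
        by (simp add: prod_eq_iff)
    qed
  qed (auto simp: div_mod_less)
  from bij_betw_same_card[OF this] bij_betw_finite[OF this]
  show "card ?D = b * (n * n)" "finite ?D" by (simp_all add: card_cartesian_product)
qed

lemma rep_mat_surj:
  assumes "m > 0" "X \<in> block_mats (gca_blocks m d) (m ^ (d div 2))"
  obtains p where "p \<in> carrier (free_alg d)" "rep_mat m (gca_rank d) p = X"
proof -
  let ?n = "m ^ (d div 2)" and ?b = "gca_blocks m d" and ?P = "gca_rank d"
  let ?I = "gca_indices m d"
  let ?W = "\<lambda>J. word_mat m ?P (monom_word d J)"
  define D where "D = {p. fst p < ?b * ?n \<and> snd p < ?b * ?n \<and> fst p div ?n = snd p div ?n}"
  have n: "?n > 0" using assms(1) by simp
  have "card ?I = card D"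
  proof -
    have "card ?I = m ^ d" by (simp add: gca_indices_def card_PiE)
    \<comment> \<open>Number of blocks times block dimension: one block of dimension m ^ d for even
      \<open>d\<close>, and m blocks of dimension m ^ (d - 1) for odd \<open>d\<close>.\<close>
    also have "\<dots> = ?b * (?n * ?n)"
      by (auto simp: gca_blocks_def power_add[symmetric] mult_2[symmetric] elim!: evenE oddE)
    finally show ?thesis unfolding D_def card_same_block(1)[OF n] .
  qed
  moreover have "u J = 0" if zero: "\<And>p. p \<in> D \<Longrightarrow> (\<Sum>J\<in>?I. u J * ?W J $$ p) = 0" and J: "J \<in> ?I" for u J
  proof (rule monom_mats_independent[OF assms(1) gca_rank_ge _ J, of u])
    fix i j assume ij: "i < m ^ ?P" "j < m ^ ?P"
    show "(\<Sum>J\<in>?I. u J * ?W J $$ (i, j)) = 0"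
    proof (cases "(i, j) \<in> D")
      \<comment> \<open>Independence was proved for all matrix positions but is now assumed to fail
        only on \<open>D\<close>. Off the blocks every monomial matrix vanishes, which supplies the
        missing equations.\<close>
      case False
      then have "?W J $$ (i, j) = 0" for J
        using block_matsD(2)[OF word_mat_in_block_mats[OF set_monom_word], of i m d j] ij
        by (simp add: D_def gca_blocks_mult)
      then show ?thesis by simp
    qed (rule zero)
  qed
  ultimately obtain u where u: "\<And>p. p \<in> D \<Longrightarrow> (\<Sum>J\<in>?I. u J * ?W J $$ p) = X $$ p"
    using independent_family_spans[of ?I D "\<lambda>J p. ?W J $$ p" "\<lambda>p. X $$ p"]
      finite_gca_indices card_same_block(2)[OF n] unfolding D_def by blast
  have "rep_mat m ?P (gca_comb m d ?I u) = X"
  proof (rule eq_matI)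
    fix i j assume "i < dim_row X" "j < dim_col X"
    then have ij: "i < ?b * ?n" "j < ?b * ?n" using block_matsD(1)[OF assms(2)] by auto
    show "rep_mat m ?P (gca_comb m d ?I u) $$ (i, j) = X $$ (i, j)"
    proof (cases "(i, j) \<in> D")
      case True
      then show ?thesis
        using u[OF True] ij by (simp add: index_rep_mat_gca_comb gca_blocks_mult)
    next
      case False
      then have "i div ?n \<noteq> j div ?n" using ij by (simp add: D_def)
      then show ?thesis
        using block_matsD(2)[OF assms(2) ij] block_matsD(2)[OF rep_mat_in_block_mats[OF gca_comb_closed] ij]
        by simp
    qed
  qed (use block_matsD(1)[OF assms(2)] carrier_matD[OF rep_mat_carrier] gca_blocks_mult in auto)
  with gca_comb_closed show ?thesis by (rule that)
qed

section \<open>The determinant\<close>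

lemma gca_class_hom:
  shows gca_class_closed: "p \<in> carrier (free_alg d) \<Longrightarrow> gca_class m d p \<in> carrier (gca m d)"
    and gca_class_mult: "p \<in> carrier (free_alg d) \<Longrightarrow> q \<in> carrier (free_alg d) \<Longrightarrow>
      gca_class m d (p * q) = gca_class m d p \<otimes>\<^bsub>gca m d\<^esub> gca_class m d q"
    and gca_class_add: "p \<in> carrier (free_alg d) \<Longrightarrow> q \<in> carrier (free_alg d) \<Longrightarrow>
      gca_class m d (p + q) = gca_class m d p \<oplus>\<^bsub>gca m d\<^esub> gca_class m d q"
    and gca_class_one: "gca_class m d 1 = \<one>\<^bsub>gca m d\<^esub>"
proof -
  note hom = ideal.rcos_ring_hom[OF ideal_gca_ideal, of d m, folded gca_def]
  show "gca_class m d p \<in> carrier (gca m d)" if "p \<in> carrier (free_alg d)"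
    unfolding gca_class_def by (rule Ring.ring_hom_closed[OF hom that])
  show "gca_class m d (p * q) = gca_class m d p \<otimes>\<^bsub>gca m d\<^esub> gca_class m d q"
    if "p \<in> carrier (free_alg d)" "q \<in> carrier (free_alg d)"
    unfolding gca_class_def using Ring.ring_hom_mult[OF hom that] by simp
  show "gca_class m d (p + q) = gca_class m d p \<oplus>\<^bsub>gca m d\<^esub> gca_class m d q"
    if "p \<in> carrier (free_alg d)" "q \<in> carrier (free_alg d)"
    unfolding gca_class_def using Ring.ring_hom_add[OF hom that] by simp
  show "gca_class m d 1 = \<one>\<^bsub>gca m d\<^esub>"
    unfolding gca_class_def using Ring.ring_hom_one[OF hom] by simp
qed

lemma gca_carrierE:
  assumes "U \<in> carrier (gca m d)"
  obtains p where "p \<in> carrier (free_alg d)" "U = gca_class m d p"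
  using assms unfolding gca_def gca_class_def FactRing_def A_RCOSETS_def' by auto

lemma gca_class_eq_iff:
  assumes "p \<in> carrier (free_alg d)" "q \<in> carrier (free_alg d)"
  shows "gca_class m d p = gca_class m d q \<longleftrightarrow> gca_eqv m d p q"
proof -
  interpret ring "free_alg d" by (rule ring_free_alg)
  have "p \<ominus>\<^bsub>free_alg d\<^esub> q = p - q"
    unfolding a_minus_def free_alg_a_inv[OF assms(2)] by simp
  then show ?thesis
    using quotient_eq_iff_same_a_r_cos[OF ideal_gca_ideal assms, of m] by (simp add: gca_class_def gca_eqv_def)
qed

lemma gca_smult_class:
  "p \<in> carrier (free_alg d) \<Longrightarrow> gca_smult m d c (gca_class m d p) = gca_class m d (nc_const c * p)"
  unfolding gca_smult_def by (rule gca_class_mult[OF free_alg_const, symmetric])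

lemma free_alg_one: "1 \<in> carrier (free_alg d)"
  by (simp add: in_free_alg zero_nc_word_def)

lemma gca_monom_class: "gca_monom m d J = gca_class m d (Poly_Mapping.single (Word (monom_word d J)) 1)"
proof -
  have pow: "gca_gen m d k [^]\<^bsub>gca m d\<^esub> n = gca_class m d (Poly_Mapping.single (Word (replicate n k)) 1)"
    if k: "k \<in> {1..d}" for k and n :: nat
  proof -
    have var: "nc_var k \<in> carrier (free_alg d)"
      unfolding nc_var_def using k by (intro free_alg_single) simp
    have pow: "nc_var k ^ n \<in> carrier (free_alg d)" for n
      unfolding nc_var_power using k by (intro free_alg_single) auto
    have "gca_gen m d k [^]\<^bsub>gca m d\<^esub> n = gca_class m d (nc_var k ^ n)"
    proof (induction n)
      case 0
      show ?case by (simp add: gca_class_one)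
    next
      case (Suc n)
      then show ?case
        using gca_class_mult[OF pow var, of m n] by (simp add: gca_gen_def power_Suc2 del: power_Suc)
    qed
    then show ?thesis by (simp add: nc_var_power)
  qed
  have "foldr (\<lambda>k V. (gca_gen m d k [^]\<^bsub>gca m d\<^esub> J k) \<otimes>\<^bsub>gca m d\<^esub> V) ks \<one>\<^bsub>gca m d\<^esub>
      = gca_class m d (Poly_Mapping.single (Word (concat (map (\<lambda>k. replicate (J k) k) ks))) 1)"
    if "set ks \<subseteq> {1..d}" for ks
    using that
  proof (induction ks)
    case Nil
    show ?case
      by (simp add: gca_class_one flip: zero_nc_word_def)
  next
    case (Cons k ks)
    have k: "k \<in> {1..d}" using Cons.prems by simp
    have "gca_class m d (Poly_Mapping.single (Word (replicate (J k) k)) 1 *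
          Poly_Mapping.single (Word (concat (map (\<lambda>k. replicate (J k) k) ks))) 1)
        = gca_class m d (Poly_Mapping.single (Word (replicate (J k) k)) 1) \<otimes>\<^bsub>gca m d\<^esub>
          gca_class m d (Poly_Mapping.single (Word (concat (map (\<lambda>k. replicate (J k) k) ks))) 1)"
      using Cons.prems by (intro gca_class_mult free_alg_single) auto
    with Cons show ?case
      by (simp add: pow[OF k] mult_single plus_nc_word_def)
  qed
  from this[of "[1..<Suc d]"] show ?thesis
    unfolding gca_monom_def monom_word_def by (simp add: atLeastLessThanSuc_atLeastAtMost del: upt_Suc)
qed

lemma gca_finsum_class:
  assumes "finite S" "\<And>J. J \<in> S \<Longrightarrow> f J \<in> carrier (free_alg d)"
  shows "(\<Oplus>\<^bsub>gca m d\<^esub>J\<in>S. gca_class m d (f J)) = gca_class m d (\<Sum>J\<in>S. f J)"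
  using assms
proof (induction S)
  case empty
  interpret G: ring "gca m d" by (rule ring_gca)
  interpret I: ideal "gca_ideal m d" "free_alg d" by (rule ideal_gca_ideal)
  have "gca_class m d 0 = gca_ideal m d"
    unfolding gca_class_def using I.a_rcos_const[OF gca_ideal_zero] by simp
  moreover have "\<zero>\<^bsub>gca m d\<^esub> = gca_ideal m d"
    by (simp add: gca_def FactRing_def)
  ultimately show ?case by simp
next
  case (insert J S)
  interpret G: ring "gca m d" by (rule ring_gca)
  have cl: "gca_class m d (f K) \<in> carrier (gca m d)" if "K \<in> insert J S" for K
    by (rule gca_class_closed) (use insert.prems that in auto)
  show ?case
    using insert cl gca_class_add[of "f J" d "sum f S" m] free_alg_sum[of S f d]
    by (subst G.finsum_insert) auto
qed

lemma gca_comb_class: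
  "(\<Oplus>\<^bsub>gca m d\<^esub>J\<in>gca_indices m d. gca_smult m d (u J) (gca_monom m d J))
    = gca_class m d (gca_comb m d (gca_indices m d) u)"
proof -
  have "gca_smult m d (u J) (gca_monom m d J) = gca_class m d (Poly_Mapping.single (Word (monom_word d J)) (u J))" for J
    unfolding gca_monom_class gca_smult_class[OF free_alg_single[OF set_monom_word]]
    by (simp add: nc_const_mult_single)
  then show ?thesis
    unfolding gca_comb_def
    by (simp only: gca_finsum_class[OF finite_gca_indices free_alg_single[OF set_monom_word]])
qed

text \<open>The ideal is the kernel of \<open>rep_mat\<close>, so a coset has a one-element image.
  This is the form in which the isomorphism theorem for factor rings presents the induced
  map.\<close>

definition std_rep :: "nat \<Rightarrow> nat \<Rightarrow> nc_poly set \<Rightarrow> complex mat" where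
  "std_rep m d U = the_elem (rep_mat m (gca_rank d) ` U)"

lemma std_rep_class:
  assumes "m > 0" "p \<in> carrier (free_alg d)"
  shows "std_rep m d (gca_class m d p) = rep_mat m (gca_rank d) p"
proof -
  interpret h: ring_hom_ring "free_alg d" "ring_mat TYPE(complex) (m ^ gca_rank d) ()" "rep_mat m (gca_rank d)"
    by (rule rep_mat_ring_hom)
  show ?thesis
    using h.the_elem_simp[OF assms(2)] unfolding gca_ideal_eq_kernel[OF assms(1) gca_rank_ge]
    by (simp add: std_rep_def gca_class_def)
qed

lemma std_rep_in_reps:
  assumes "m > 0"
  shows "std_rep m d \<in> gca_reps m d"
proof -
  interpret h: ring_hom_ring "free_alg d" "ring_mat TYPE(complex) (m ^ gca_rank d) ()" "rep_mat m (gca_rank d)"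
    by (rule rep_mat_ring_hom)
  have "rep_mat m (gca_rank d) ` carrier (free_alg d) = block_mats (gca_blocks m d) (m ^ (d div 2))"
    using rep_mat_in_block_mats rep_mat_surj[OF assms] by blast
  then have "std_rep m d \<in> ring_iso (gca m d) (gca_mat_ring m d)"
    using h.FactRing_iso_set_aux
    unfolding gca_ideal_eq_kernel[OF assms gca_rank_ge] gca_def gca_mat_ring_eq[OF assms] std_rep_def[abs_def]
    by simp
  moreover have "std_rep m d (gca_smult m d c U) = c \<cdot>\<^sub>m std_rep m d U" if "U \<in> carrier (gca m d)" for c U
    using that
  proof (rule gca_carrierE)
    fix p assume p: "p \<in> carrier (free_alg d)" and U: "U = gca_class m d p"
    show ?thesis
      unfolding U gca_smult_class[OF p] std_rep_class[OF assms p]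
        std_rep_class[OF assms free_alg_mult_closed[OF free_alg_const p]] rep_mat_const_mult ..
  qed
  ultimately show ?thesis by (simp add: gca_reps_def)
qed

text \<open>The composite of \<gamma> with the inverse of the standard representation is a unital
  injective endomorphism of the block algebra and so preserves determinants; it is evaluated at the
  standard matrix of \<open>U\<close>.\<close>

lemma det_gca_reps:
  assumes "m > 0" "\<gamma> \<in> gca_reps m d" "U \<in> carrier (gca m d)"
  shows "det (\<gamma> U) = det (std_rep m d U)"
proof -
  let ?b = "gca_blocks m d" and ?n = "m ^ (d div 2)"
  let ?B = "block_mats ?b ?n" and ?G = "gca m d"
  interpret G: ring ?G by (rule ring_gca)
  have iso: "\<delta> \<in> ring_iso ?G (ring_mat TYPE(complex) (m ^ gca_rank d) () \<lparr>carrier := ?B\<rparr>)"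
    if "\<delta> \<in> gca_reps m d" for \<delta>
    using that unfolding gca_reps_def gca_mat_ring_eq[OF assms(1)] by blast
  have lin: "\<delta> (gca_smult m d c V) = c \<cdot>\<^sub>m \<delta> V"
    if "\<delta> \<in> gca_reps m d" "V \<in> carrier ?G" for \<delta> c V
    using that unfolding gca_reps_def by blast
  have bij: "bij_betw \<delta> (carrier ?G) ?B" if "\<delta> \<in> gca_reps m d" for \<delta>
    using ring_iso_memE(5)[OF iso[OF that]] by simp
  have mult: "\<delta> (V \<otimes>\<^bsub>?G\<^esub> W) = \<delta> V * \<delta> W"
    if "\<delta> \<in> gca_reps m d" "V \<in> carrier ?G" "W \<in> carrier ?G" for \<delta> V W
    using ring_iso_memE(2)[OF iso[OF that(1)] that(2,3)] by (simp add: ring_mat_def)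
  have add: "\<delta> (V \<oplus>\<^bsub>?G\<^esub> W) = \<delta> V + \<delta> W"
    if "\<delta> \<in> gca_reps m d" "V \<in> carrier ?G" "W \<in> carrier ?G" for \<delta> V W
    using ring_iso_memE(3)[OF iso[OF that(1)] that(2,3)] by (simp add: ring_mat_def)
  have one: "\<delta> \<one>\<^bsub>?G\<^esub> = 1\<^sub>m (?b * ?n)" if "\<delta> \<in> gca_reps m d" for \<delta>
    using ring_iso_memE(4)[OF iso[OF that]] by (simp add: ring_mat_def gca_blocks_mult)
  let ?\<sigma> = "std_rep m d"
  note \<sigma> = std_rep_in_reps[OF assms(1), of d]
  define \<psi> where "\<psi> = inv_into (carrier ?G) ?\<sigma>"
  have \<psi>: "\<psi> X \<in> carrier ?G" "?\<sigma> (\<psi> X) = X" if "X \<in> ?B" for X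
    unfolding \<psi>_def using bij_betwE[OF bij_betw_inv_into[OF bij[OF \<sigma>]]] that
      bij_betw_inv_into_right[OF bij[OF \<sigma>] that] by blast+
  \<comment> \<open>Every homomorphism law for the inverse map follows from this: it suffices to
    check that the proposed preimage is sent to the right matrix.\<close>
  have \<psi>_eq: "\<psi> X = V" if "X \<in> ?B" "V \<in> carrier ?G" "?\<sigma> V = X" for X V
    using bij_betw_inv_into_left[OF bij[OF \<sigma>] that(2)] that(3) by (simp add: \<psi>_def)
  have smult_closed: "gca_smult m d c V \<in> carrier ?G" if "V \<in> carrier ?G" for c V
    unfolding gca_smult_def by (intro G.m_closed that gca_class_closed free_alg_const)
  have "det (\<gamma> (\<psi> X)) = det X" if X: "X \<in> ?B" for X
  proof (rule det_block_mats_endomorphism[of ?b ?n "\<lambda>X. \<gamma> (\<psi> X)", OF _ _ _ _ _ _ X])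
    note b = bij[OF assms(2)]
    show "\<gamma> (\<psi> X) \<in> carrier_mat (?b * ?n) (?b * ?n)" if "X \<in> ?B" for X
      using bij_betwE[OF b] \<psi>(1)[OF that] block_matsD(1) by blast
    show "\<gamma> (\<psi> (X + Y)) = \<gamma> (\<psi> X) + \<gamma> (\<psi> Y)" if "X \<in> ?B" "Y \<in> ?B" for X Y
    proof -
      note c = \<psi>(1)[OF that(1)] \<psi>(1)[OF that(2)]
      have "\<psi> (X + Y) = \<psi> X \<oplus>\<^bsub>?G\<^esub> \<psi> Y"
        by (rule \<psi>_eq[OF add_in_block_mats[OF that] G.a_closed[OF c]]) (simp only: add[OF \<sigma> c] \<psi>(2)[OF that(1)] \<psi>(2)[OF that(2)])
      then show ?thesis by (simp only: add[OF assms(2) c])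
    qed
    show "\<gamma> (\<psi> (X * Y)) = \<gamma> (\<psi> X) * \<gamma> (\<psi> Y)" if "X \<in> ?B" "Y \<in> ?B" for X Y
    proof -
      note c = \<psi>(1)[OF that(1)] \<psi>(1)[OF that(2)]
      have "\<psi> (X * Y) = \<psi> X \<otimes>\<^bsub>?G\<^esub> \<psi> Y"
        by (rule \<psi>_eq[OF mult_in_block_mats[OF that] G.m_closed[OF c]]) (simp only: mult[OF \<sigma> c] \<psi>(2)[OF that(1)] \<psi>(2)[OF that(2)])
      then show ?thesis by (simp only: mult[OF assms(2) c])
    qed
    show "\<gamma> (\<psi> (c \<cdot>\<^sub>m X)) = c \<cdot>\<^sub>m \<gamma> (\<psi> X)" if "X \<in> ?B" for c X
    proof -
      have "\<psi> (c \<cdot>\<^sub>m X) = gca_smult m d c (\<psi> X)"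
        by (rule \<psi>_eq[OF smult_in_block_mats[OF that] smult_closed[OF \<psi>(1)[OF that]]])
          (simp only: lin[OF \<sigma> \<psi>(1)[OF that]] \<psi>(2)[OF that])
      then show ?thesis by (simp only: lin[OF assms(2) \<psi>(1)[OF that]])
    qed
    have "\<psi> (1\<^sub>m (?b * ?n)) = \<one>\<^bsub>?G\<^esub>"
      by (rule \<psi>_eq[OF one_in_block_mats G.one_closed one[OF \<sigma>]])
    then show "\<gamma> (\<psi> (1\<^sub>m (?b * ?n))) = 1\<^sub>m (?b * ?n)"
      by (simp only: one[OF assms(2)])
    show "inj_on (\<lambda>X. \<gamma> (\<psi> X)) ?B"
    proof (rule inj_onI)
      fix X Y assume XY: "X \<in> ?B" "Y \<in> ?B" "\<gamma> (\<psi> X) = \<gamma> (\<psi> Y)"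
      have "\<psi> X = \<psi> Y"
        by (rule inj_onD[OF bij_betw_imp_inj_on[OF b] XY(3) \<psi>(1)[OF XY(1)] \<psi>(1)[OF XY(2)]])
      then have "?\<sigma> (\<psi> X) = ?\<sigma> (\<psi> Y)" by (rule arg_cong)
      then show "X = Y" unfolding \<psi>(2)[OF XY(1)] \<psi>(2)[OF XY(2)] .
    qed
  qed
  note det = this
  have B: "?\<sigma> U \<in> ?B" using bij_betwE[OF bij[OF \<sigma>]] assms(3) by blast
  have "\<psi> (?\<sigma> U) = U"
    by (rule \<psi>_eq[OF B assms(3) refl])
  with det[OF B] show ?thesis by simp
qed

lemma gca_Det_std_rep:
  assumes "m > 0" "U \<in> carrier (gca m d)"
  shows "gca_Det m d U = det (std_rep m d U)"
  unfolding gca_Det_def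
proof (rule the_equality)
  show "\<exists>\<gamma>\<in>gca_reps m d. det (std_rep m d U) = det (\<gamma> U)"
    using std_rep_in_reps[OF assms(1)] by blast
  show "z = det (std_rep m d U)" if "\<exists>\<gamma>\<in>gca_reps m d. z = det (\<gamma> U)" for z
    using that det_gca_reps[OF assms(1) _ assms(2)] by blast
qed

text \<open>This discharges the definite description of the coefficients: spanning gives existence
  and independence of the monomial matrices gives uniqueness.\<close>

lemma gca_coeffs_class:
  assumes "m > 0" "U \<in> carrier (gca m d)"
  shows "U = gca_class m d (gca_comb m d (gca_indices m d) (gca_coeffs m d U))"
proof -
  let ?I = "gca_indices m d"
  obtain p where p: "p \<in> carrier (free_alg d)" "U = gca_class m d p"
    by (rule gca_carrierE[OF assms(2)])
  obtain u where "gca_eqv m d p (gca_comb m d ?I u)"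
    by (rule gca_eqv_gca_comb[OF assms(1) p(1)])
  then have u: "U = gca_class m d (gca_comb m d ?I u)"
    using p gca_class_eq_iff[OF p(1) gca_comb_closed] by blast
  \<comment> \<open>The description ranges over extensional families, so the coefficients found by
    spanning are made undefined off the index set.\<close>
  have "gca_comb m d ?I (restrict u ?I) = gca_comb m d ?I u"
    by (simp add: gca_comb_def)
  with u have ex: "restrict u ?I \<in> extensional ?I \<and> U = gca_class m d (gca_comb m d ?I (restrict u ?I))"
    by simp
  have unique: "v = restrict u ?I"
    if v: "v \<in> extensional ?I \<and> U = gca_class m d (gca_comb m d ?I v)" for v
  proof (rule extensionalityI[of _ ?I])
    have "rep_mat m (gca_rank d) (gca_comb m d ?I v) = rep_mat m (gca_rank d) (gca_comb m d ?I u)"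
      using v u std_rep_class[OF assms(1) gca_comb_closed] by metis
    then have "v J - u J = 0" if "J \<in> ?I" for J
      by (intro monom_mats_independent[OF assms(1) gca_rank_ge _ that, of "\<lambda>J. v J - u J"])
        (simp add: left_diff_distrib sum_subtractf flip: index_rep_mat_gca_comb)
    then show "v J = restrict u ?I J" if "J \<in> ?I" for J using that by simp
  qed (use v in auto)
  have "gca_coeffs m d U = restrict u ?I"
    unfolding gca_coeffs_def gca_comb_class using ex unique by (intro the_equality)
  with ex show ?thesis by simp
qed

section \<open>Hermitian conjugation as conjugate transposition\<close>

lemma index_rep_mat_sum:
  assumes "i < m ^ P" "j < m ^ P"
  shows "rep_mat m P (sum f S) $$ (i, j) = (\<Sum>x\<in>S. rep_mat m P (f x) $$ (i, j))"
  using assms carrier_matD[OF rep_mat_carrier]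
  by (induction S rule: infinite_finite_induct) (simp_all add: rep_mat_zero rep_mat_add)

lemma dagger_in_block_mats: "X \<in> block_mats b n \<Longrightarrow> dagger X \<in> block_mats b n"
  using block_matsD[of X b n]
  by (intro block_matsI dagger_carrier) (auto simp: index_dagger)

text \<open>The ring inverse of a monomial is found through the matrices: surjectivity lifts the
  conjugate transpose of its unitary matrix to the algebra, and faithfulness shows that the lift is
  the inverse. Conjugating the coefficients then makes the whole sum represent the conjugate
  transpose.\<close>

lemma gca_conj_class:
  assumes "m > 0" "U \<in> carrier (gca m d)"
  obtains q where "q \<in> carrier (free_alg d)" "gca_conj m d U = gca_class m d q"
    "rep_mat m (gca_rank d) q = dagger (std_rep m d U)"
proof -
  let ?P = "gca_rank d" and ?I = "gca_indices m d" and ?G = "gca m d"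
  interpret G: ring ?G by (rule ring_gca)
  define u where "u = gca_coeffs m d U"
  let ?M = "\<lambda>J. Poly_Mapping.single (Word (monom_word d J)) 1 :: nc_poly"
  let ?W = "\<lambda>J. word_mat m ?P (monom_word d J)"
  have M: "?M J \<in> carrier (free_alg d)" for J
    by (intro free_alg_single set_monom_word)
  have repM: "rep_mat m ?P (?M J) = ?W J" for J
    unfolding rep_mat_single by (auto intro!: eq_matI)
  \<comment> \<open>Conjugate transposition preserves the block form, so the matrix lies in the
    image of the representation.\<close>
  have "\<exists>q. q \<in> carrier (free_alg d) \<and> rep_mat m ?P q = dagger (?W J)" for J
    using rep_mat_surj[OF assms(1) dagger_in_block_mats[OF word_mat_in_block_mats[OF set_monom_word]]] by metis
  then obtain q where q: "\<And>J. q J \<in> carrier (free_alg d)" "\<And>J. rep_mat m ?P (q J) = dagger (?W J)"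
    by metis
  have unit: "dagger (?W J) * ?W J = 1\<^sub>m (m ^ ?P)" "?W J * dagger (?W J) = 1\<^sub>m (m ^ ?P)" for J
    using unitary_word_mat by (auto simp: unitary_mat_def)
  \<comment> \<open>Faithfulness: a product whose matrix is the identity has the class of 1.\<close>
  have one: "gca_class m d (a * b) = \<one>\<^bsub>?G\<^esub>"
    if "a \<in> carrier (free_alg d)" "b \<in> carrier (free_alg d)" "rep_mat m ?P (a * b) = rep_mat m ?P 1" for a b
  proof -
    have "a * b - 1 \<in> carrier (free_alg d)"
      using free_alg_add[OF free_alg_mult_closed[OF that(1,2)] free_alg_uminus[OF free_alg_one]] by simp
    then have "gca_eqv m d (a * b) 1"
      unfolding gca_eqv_def using that(3)
      by (intro rep_mat_eq_zero_imp_ideal[OF assms(1) gca_rank_ge]) (simp_all add: rep_mat_diff)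
    then show ?thesis
      using gca_class_eq_iff[OF free_alg_mult_closed[OF that(1,2)] free_alg_one] gca_class_one
      by metis
  qed
  have inv: "inv\<^bsub>?G\<^esub> (gca_monom m d J) = gca_class m d (q J)" for J
    unfolding gca_monom_class
    by (rule G.inv_char)
      (simp_all add: gca_class_closed[OF M] gca_class_closed[OF q(1)] M q one rep_mat_mult rep_mat_one repM unit flip: gca_class_mult)
  define Q where "Q = (\<Sum>J\<in>?I. nc_const (cnj (u J)) * q J)"
  have Qc: "nc_const (cnj (u J)) * q J \<in> carrier (free_alg d)" for J
    by (intro free_alg_mult_closed free_alg_const q)
  have "gca_conj m d U = gca_class m d Q"
    unfolding gca_conj_def inv gca_smult_class[OF q(1)] u_def[symmetric] Q_def
    by (rule gca_finsum_class[OF finite_gca_indices Qc])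
  moreover have "rep_mat m ?P Q = dagger (std_rep m d U)"
  proof -
    have U: "std_rep m d U = rep_mat m ?P (gca_comb m d ?I u)"
      using gca_coeffs_class[OF assms] std_rep_class[OF assms(1) gca_comb_closed] u_def by metis
    show ?thesis
      unfolding U
    proof (rule eq_matI)
      fix i j assume "i < dim_row (dagger (rep_mat m ?P (gca_comb m d ?I u)))"
        "j < dim_col (dagger (rep_mat m ?P (gca_comb m d ?I u)))"
      then have ij: "i < m ^ ?P" "j < m ^ ?P"
        using carrier_matD[OF dagger_carrier[OF rep_mat_carrier[of m ?P "gca_comb m d ?I u"]]] by auto
      have "rep_mat m ?P Q $$ (i, j) = (\<Sum>J\<in>?I. cnj (u J) * cnj (?W J $$ (j, i)))"
        unfolding Q_def index_rep_mat_sum[OF ij] rep_mat_const_mult q(2)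
        using ij carrier_matD[OF dagger_carrier[OF word_mat_carrier]]
        by (intro sum.cong) (auto simp: index_dagger[OF word_mat_carrier])
      also have "\<dots> = cnj (rep_mat m ?P (gca_comb m d ?I u) $$ (j, i))"
        unfolding index_rep_mat_gca_comb[OF ij(2,1)] by simp
      finally show "rep_mat m ?P Q $$ (i, j) = dagger (rep_mat m ?P (gca_comb m d ?I u)) $$ (i, j)"
        using ij by (simp add: index_dagger[OF rep_mat_carrier])
    qed (use carrier_matD[OF dagger_carrier[OF rep_mat_carrier]] carrier_matD[OF rep_mat_carrier] in auto)
  qed
  moreover have "Q \<in> carrier (free_alg d)"
    unfolding Q_def by (intro free_alg_sum Qc)
  ultimately show ?thesis using that by blast
qed

theorem corollary7p4:
  fixes m d :: nat
  assumes "m \<ge> 2" and "d \<ge> 1"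
  shows "\<forall>U\<in>carrier (gca m d). gca_Det m d U = cnj (gca_Det m d (gca_conj m d U))"
proof
  fix U assume U: "U \<in> carrier (gca m d)"
  have m: "m > 0" using assms(1) by simp
  obtain p where p: "p \<in> carrier (free_alg d)" "U = gca_class m d p"
    by (rule gca_carrierE[OF U])
  have S: "std_rep m d U \<in> carrier_mat (m ^ gca_rank d) (m ^ gca_rank d)"
    unfolding p(2) std_rep_class[OF m p(1)] by (rule rep_mat_carrier)
  obtain q where q: "q \<in> carrier (free_alg d)" "gca_conj m d U = gca_class m d q"
    "rep_mat m (gca_rank d) q = dagger (std_rep m d U)"
    by (rule gca_conj_class[OF m U])
  have "gca_Det m d (gca_conj m d U) = det (dagger (std_rep m d U))"
    unfolding q(2) gca_Det_std_rep[OF m gca_class_closed[OF q(1)]] std_rep_class[OF m q(1)] q(3) ..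
  then show "gca_Det m d U = cnj (gca_Det m d (gca_conj m d U))"
    by (simp add: gca_Det_std_rep[OF m U] det_dagger[OF S])
qed

end
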